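(* Let $m\ge2$ be an integer and let $\mathcal G=(\mathcal E,\{m_e=m\},\{d_i\})$ be a network on a finite connected simple graph that contains at least one loop, with all bond dimensions equal to $m$ and site dimensions $d_i\ge m^{z_i}$, where $z_i$ is the degree of vertex $i$. Let $|\psi_T\rangle=|\psi_T(\varepsilon)\rangle\in\mathrm{PEPS}(\mathcal G)$, $\varepsilon>0$, be a family of two-domain loop states along some loop in $\mathcal G$ as defined in the context. Let $\mathcal G'$ be a fine-grained version of $\mathcal G$, consisting of $N_c$ interconnected clusters, each corresponding to exactly one vertex of $\mathcal G$, such that the product of the bond dimensions of those edges of $\mathcal G'$ that get combined into an edge $e$ of $\mathcal G$ under the blocking $\mathcal G'\to\mathcal G$ equals the bond dimension $m_e$, and such that the bond dimensions of $\mathcal G'$ can accommodate the tensors of a fine-grained version of $|\psi_T\rangle$, i.e. for every $\varepsilon>0$ there is a fine-grained version $|\psi_T'\rangle\in\mathrm{PEPS}(\mathcal G')$ of $|\psi_T(\varepsilon)\rangle$, with a blocking scheme independent of $\varepsilon$. Apart from that, the bond dimensions of edges inside the clusters are arbitrary. Then the set $\mathrm{PEPS}(\mathcal G')$ of normalized projected entangled-pair states for $\mathcal G'$ is not closed.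
   Context: **PEPS.** A network $\mathcal G=(\mathcal E,\{m_e\},\{d_i\})$ is a finite connected graph with edge set $\mathcal E$, bond dimensions $m_e$ for the edges and site dimensions $d_i$ for the vertices, with site Hilbert spaces $\mathcal H_i=\mathbb C^{d_i}$ with orthonormal bases $\{|\sigma_i\rangle\}$. With $\partial i$ the set of edges incident to $i$, a PEPS is obtained by assigning to each vertex a tensor $A_i\in\mathbb C^{d_i\times\prod_{e\in\partial i}m_e}$ and contracting: $|\Psi\rangle=\sum_{\boldsymbol\sigma}\sum_{\{n_e\}}\prod_i[A_i^{\sigma_i}]_{(n_e)_{e\in\partial i}}|\boldsymbol\sigma\rangle$ with $n_e\in\{1,\dots,m_e\}$. $\mathrm{PEPS}(\mathcal G)$ is the set of such states with norm $1$, as a subset of $\bigotimes_i\mathcal H_i$. Closedness is with respect to the norm topology. **The states $|\psi_T\rangle$.** Let $\mathcal G$ have all $m_e=m$ and $d_i\ge m^{z_i}$. For each edge $e\in\partial i$ let $\mathcal V_{i,e}\simeq\mathbb C^m$ with orthonormal basis $\{|n\rangle\}_{n=1}^m$, and regard $\bigotimes_{e\in\partial i}\mathcal V_{i,e}$ as a subspace of $\mathcal H_i$ (equal to $\mathcal H_i$ if $d_i=m^{z_i}$). Let $|\mu\rangle=\bigotimes_{e\in\mathcal E}\big(\sum_{n=1}^m|n,n\rangle_e\big)$, where for an edge $e$ joining $i$ and $j$, $\sum_n|n,n\rangle_e\in\mathcal V_{i,e}\otimes\mathcal V_{j,e}$. On $\mathbb C^m\otimes\mathbb C^m$ define $\hat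 P_d=\sum_{n=1}^m|n,n\rangle\langle n,n|$, $\hat P_o=\mathbb 1-\hat P_d$, and for $\varepsilon>0$ $$\hat A=\hat P_d+\varepsilon\hat P_o,\qquad \hat B=\tfrac1\varepsilon(\hat P_o+\varepsilon\hat P_d).$$ Choose a loop (cycle) $\mathcal C=(i_1,i_2,\dots,i_L)$ of distinct vertices in the graph. If the loop enters vertex $i_k$ through edge $e$ and leaves it through edge $e'$, apply $\hat A$ (for $k<L$), respectively $\hat B$ (for $k=L$), to the factor $\mathcal V_{i_k,e}\otimes\mathcal V_{i_k,e'}$ of $|\mu\rangle$, and the identity everywhere else. $|\psi_T(\varepsilon)\rangle$ is the resulting state, normalized to norm $1$. **Fine-graining of networks.** $\mathcal G'=(\mathcal E',\{m'_e\},\{d'_j\})$ is a fine-grained version of $\mathcal G=(\mathcal E,\{m_e\},\{d_i\})$ if there is a blocking scheme mapping $\mathcal G'$ onto $\mathcal G$: the graph of $\mathcal G'$ is partitioned into clusters, each cluster $C_i$ corresponding to exactly one vertex $i$ of $\mathcal G$ such that $d_i=\prod_{j\in C_i}d'_j$; the edge $e$ of $\mathcal G$ joining vertices $i$ and $j$ corresponds to all edges of $\mathcal G'$ that join the clusters $C_i$ and $C_j$, and the product of the bond dimensions of the latter equals $m_e$ (clusters whose vertices are not adjacent in $\mathcal G$ are not joined by edges of $\mathcal G'$). **Fine-graining of states.** $|\Psi'\rangle\in\mathrm{PEPS}(\mathcal G')$ is a fine-grained version of $|\Psi\rangle\in\mathrm{PEPS}(\mathcal G)$ if $\mathcal G'$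 is a fine-grained version of $\mathcal G$ and there is a blocking scheme mapping $|\Psi'\rangle$ to $|\Psi\rangle$: the PEPS tensor $A_i$ of $|\Psi\rangle$ is obtained by contracting the PEPS tensors of $|\Psi'\rangle$ in the cluster $C_i$ and grouping the indices of outgoing edges into one multi-index for each connected cluster $C_j$, where $\mathcal H_i$ is identified with $\bigotimes_{j\in C_i}\mathcal H'_j$ by an identification of orthonormal product bases. *)

theory Defs
  imports "HOL-Analysis.Analysis"
begin

section \<open>Networks\<close>

text \<open>The graph may have parallel edges, but no edge joins a vertex to itself. Basis states of
  a site and values of a bond index are numbered from \<open>0\<close>.\<close>

record ('v, 'e) network =
  verts :: "'v set"
  edges :: "'e set"
  ends :: "'e \<Rightarrow> 'v set"
  bdim :: "'e \<Rightarrow> nat"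
  sdim :: "'v \<Rightarrow> nat"

definition adjacency :: "('v, 'e) network \<Rightarrow> ('v \<times> 'v) set" where
  "adjacency N = {(i, j). \<exists>e\<in>edges N. ends N e = {i, j}}"

definition is_network :: "('v, 'e) network \<Rightarrow> bool" where
  "is_network N \<longleftrightarrow>
     finite (verts N) \<and> verts N \<noteq> {} \<and> finite (edges N) \<and>
     (\<forall>e\<in>edges N. ends N e \<subseteq> verts N \<and> card (ends N e) = 2) \<and>
     (\<forall>i\<in>verts N. \<forall>j\<in>verts N. (i, j) \<in> (adjacency N)\<^sup>*) \<and>
     (\<forall>e\<in>edges N. 1 \<le> bdim N e) \<and> (\<forall>i\<in>verts N. 1 \<le> sdim N i)"

definition simple_network :: "('v, 'e) network \<Rightarrow> bool" where
  "simple_network N \<longleftrightarrow> is_network N \<and> inj_on (ends N) (edges N)"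

definition incident :: "('v, 'e) network \<Rightarrow> 'v \<Rightarrow> 'e set" where
  "incident N i = {e \<in> edges N. i \<in> ends N e}"

definition vdegree :: "('v, 'e) network \<Rightarrow> 'v \<Rightarrow> nat" where
  "vdegree N i = card (incident N i)"


section \<open>States and PEPS\<close>

text \<open>A vector of \<open>\<Otimes>\<^sub>i \<complex>^d\<^sub>i\<close> is the family of its coefficients in the product basis,
  set to zero outside the finite index set of that basis.\<close>

definition site_configs :: "('v, 'e) network \<Rightarrow> ('v \<Rightarrow> nat) set" where
  "site_configs N = (\<Pi>\<^sub>E i\<in>verts N. {..<sdim N i})"

definition bond_configs :: "('v, 'e) network \<Rightarrow> 'e set \<Rightarrow> ('e \<Rightarrow> nat) set" where
  "bond_configs N S = (\<Pi>\<^sub>E e\<in>S. {..<bdim N e})"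

type_synonym 'v state = "('v \<Rightarrow> nat) \<Rightarrow> complex"

definition state_space :: "('v, 'e) network \<Rightarrow> 'v state set" where
  "state_space N = {\<psi>. \<forall>\<sigma>. \<sigma> \<notin> site_configs N \<longrightarrow> \<psi> \<sigma> = 0}"

definition state_norm :: "('v, 'e) network \<Rightarrow> 'v state \<Rightarrow> real" where
  "state_norm N \<psi> = L2_set (\<lambda>\<sigma>. cmod (\<psi> \<sigma>)) (site_configs N)"

definition state_dist :: "('v, 'e) network \<Rightarrow> 'v state \<Rightarrow> 'v state \<Rightarrow> real" where
  "state_dist N \<psi> \<phi> = state_norm N (\<lambda>\<sigma>. \<psi> \<sigma> - \<phi> \<sigma>)"

definition norm_topology :: "('v, 'e) network \<Rightarrow> 'v state topology" where
  "norm_topology N = Metric_space.mtopology (state_space N) (state_dist N)"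

type_synonym ('v, 'e) tensors = "'v \<Rightarrow> nat \<Rightarrow> ('e \<Rightarrow> nat) \<Rightarrow> complex"

definition contract :: "('v, 'e) network \<Rightarrow> ('v, 'e) tensors \<Rightarrow> 'v state" where
  "contract N A = (\<lambda>\<sigma>.
     if \<sigma> \<in> site_configs N
     then \<Sum>n\<in>bond_configs N (edges N).
            \<Prod>i\<in>verts N. A i (\<sigma> i) (restrict n (incident N i))
     else 0)"

definition PEPS :: "('v, 'e) network \<Rightarrow> 'v state set" where
  "PEPS N = {\<psi>. (\<exists>A. \<psi> = contract N A) \<and> state_norm N \<psi> = 1}"

lemma finite_site_configs: "is_network N \<Longrightarrow> finite (site_configs N)"
  unfolding is_network_def site_configs_def by (auto intro: finite_PiE)

lemma Metric_space_state:
  assumes "is_network N"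
  shows "Metric_space (state_space N) (state_dist N)"
proof
  have fin: "finite (site_configs N)"
    using assms by (rule finite_site_configs)
  fix \<psi> \<phi> \<xi> :: "'a state"
  show "0 \<le> state_dist N \<psi> \<phi>"
    by (simp add: state_dist_def state_norm_def L2_set_nonneg)
  show "state_dist N \<psi> \<phi> = state_dist N \<phi> \<psi>"
    by (simp add: state_dist_def state_norm_def norm_minus_commute)
  show "state_dist N \<psi> \<phi> = 0 \<longleftrightarrow> \<psi> = \<phi>"
    if "\<psi> \<in> state_space N" "\<phi> \<in> state_space N"
  proof -
    have "state_dist N \<psi> \<phi> = 0 \<longleftrightarrow> (\<forall>\<sigma>\<in>site_configs N. \<psi> \<sigma> = \<phi> \<sigma>)"
      using fin by (simp add: state_dist_def state_norm_def L2_set_eq_0_iff)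
    also have "\<dots> \<longleftrightarrow> \<psi> = \<phi>"
    proof
      assume eq: "\<forall>\<sigma>\<in>site_configs N. \<psi> \<sigma> = \<phi> \<sigma>"
      show "\<psi> = \<phi>"
      proof
        fix \<sigma>
        show "\<psi> \<sigma> = \<phi> \<sigma>"
          using eq that by (cases "\<sigma> \<in> site_configs N") (auto simp: state_space_def)
      qed
    qed simp
    finally show ?thesis .
  qed
  have "state_dist N \<psi> \<xi>
      \<le> L2_set (\<lambda>\<sigma>. cmod (\<psi> \<sigma> - \<phi> \<sigma>) + cmod (\<phi> \<sigma> - \<xi> \<sigma>)) (site_configs N)"
    unfolding state_dist_def state_norm_def
  proof (rule L2_set_mono)
    fix \<sigma>
    show "cmod (\<psi> \<sigma> - \<xi> \<sigma>) \<le> cmod (\<psi> \<sigma> - \<phi> \<sigma>) + cmod (\<phi> \<sigma> - \<xi> \<sigma>)"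
      using norm_triangle_ineq[of "\<psi> \<sigma> - \<phi> \<sigma>" "\<phi> \<sigma> - \<xi> \<sigma>"] by simp
  qed simp
  also have "\<dots> \<le> state_dist N \<psi> \<phi> + state_dist N \<phi> \<xi>"
    unfolding state_dist_def state_norm_def by (rule L2_set_triangle_ineq)
  finally show "state_dist N \<psi> \<xi> \<le> state_dist N \<psi> \<phi> + state_dist N \<phi> \<xi>" .
qed

lemma topspace_norm_topology: "is_network N \<Longrightarrow> topspace (norm_topology N) = state_space N"
  unfolding norm_topology_def
  by (simp add: Metric_space.topspace_mtopology Metric_space_state)

lemma PEPS_subset_state_space: "PEPS N \<subseteq> state_space N"
  by (auto simp: PEPS_def state_space_def contract_def)


section \<open>Two-domain loop states\<close>

text \<open>In the loop \<open>vs\<close>, the edge \<open>es ! k\<close> is left through at \<open>vs ! k\<close> and leads to the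
  cyclically next vertex.\<close>

definition is_loop :: "('v, 'e) network \<Rightarrow> 'v list \<Rightarrow> 'e list \<Rightarrow> bool" where
  "is_loop N vs es \<longleftrightarrow>
     3 \<le> length vs \<and> length es = length vs \<and> distinct vs \<and> distinct es \<and>
     set vs \<subseteq> verts N \<and> set es \<subseteq> edges N \<and>
     (\<forall>k<length vs. ends N (es ! k) = {vs ! k, vs ! (Suc k mod length vs)})"

text \<open>Operators on \<open>\<complex>^m \<otimes> \<complex>^m\<close> are given by their matrix elements: \<open>X (a, b) (c, d)\<close> is
  \<open>\<langle>a, b|X|c, d\<rangle>\<close>.\<close>

type_synonym two_op = "nat \<times> nat \<Rightarrow> nat \<times> nat \<Rightarrow> complex"

definition P_diag :: "nat \<Rightarrow> two_op" where
  "P_diag m x y = (\<Sum>n<m. of_bool (x = (n, n)) * of_bool (y = (n, n)))"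

definition P_off :: "nat \<Rightarrow> two_op" where
  "P_off m x y = of_bool (x = y) - P_diag m x y"

definition op_A :: "nat \<Rightarrow> real \<Rightarrow> two_op" where
  "op_A m \<epsilon> x y = P_diag m x y + complex_of_real \<epsilon> * P_off m x y"

definition op_B :: "nat \<Rightarrow> real \<Rightarrow> two_op" where
  "op_B m \<epsilon> x y =
     (1 / complex_of_real \<epsilon>) * (P_off m x y + complex_of_real \<epsilon> * P_diag m x y)"

text \<open>Vectors of \<open>\<Otimes>\<^sub>i \<Otimes>\<^sub>e \<V>\<^sub>i\<^sub>,\<^sub>e\<close> are given by their coefficients; a basis vector is
  labelled by one number below \<open>m\<close> for each half-edge \<open>(i, e)\<close>.\<close>

definition half_edges :: "('v, 'e) network \<Rightarrow> ('v \<times> 'e) set" where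
  "half_edges N = (SIGMA i:verts N. incident N i)"

definition virtual_configs :: "('v, 'e) network \<Rightarrow> nat \<Rightarrow> ('v \<times> 'e \<Rightarrow> nat) set" where
  "virtual_configs N m = (\<Pi>\<^sub>E h\<in>half_edges N. {..<m})"

type_synonym ('v, 'e) virtual_state = "('v \<times> 'e \<Rightarrow> nat) \<Rightarrow> complex"

text \<open>The coefficient of \<open>\<Sum>\<^sub>n |n, n\<rangle>\<close> on an edge is \<open>1\<close> if the labels at its two ends agree,
  and \<open>0\<close> otherwise.\<close>

definition mu_state :: "('v, 'e) network \<Rightarrow> ('v, 'e) virtual_state" where
  "mu_state N x =
     (\<Prod>e\<in>edges N. of_bool (\<forall>i\<in>ends N e. \<forall>j\<in>ends N e. x (i, e) = x (j, e)))"

definition apply_op ::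
  "nat \<Rightarrow> two_op \<Rightarrow> 'v \<times> 'e \<Rightarrow> 'v \<times> 'e \<Rightarrow> ('v, 'e) virtual_state \<Rightarrow> ('v, 'e) virtual_state"
where
  "apply_op m X h h' \<phi> x =
     (\<Sum>a<m. \<Sum>b<m. X (x h, x h') (a, b) * \<phi> (x(h := a, h' := b)))"

definition loop_op ::
  "nat \<Rightarrow> real \<Rightarrow> 'v list \<Rightarrow> 'e list \<Rightarrow> nat \<Rightarrow> ('v, 'e) virtual_state \<Rightarrow> ('v, 'e) virtual_state"
where
  "loop_op m \<epsilon> vs es k =
     (let L = length vs; e_in = es ! ((k + L - 1) mod L); e_out = es ! k
      in apply_op m (if k = L - 1 then op_B m \<epsilon> else op_A m \<epsilon>) (vs ! k, e_in) (vs ! k, e_out))"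

definition loop_virtual_state ::
  "('v, 'e) network \<Rightarrow> nat \<Rightarrow> 'v list \<Rightarrow> 'e list \<Rightarrow> real \<Rightarrow> ('v, 'e) virtual_state" where
  "loop_virtual_state N m vs es \<epsilon> = fold (loop_op m \<epsilon> vs es) [0..<length vs] (mu_state N)"

text \<open>The spaces \<open>\<Otimes>\<^sub>e \<V>\<^sub>i\<^sub>,\<^sub>e\<close> are regarded as subspaces of the site spaces through isometries,
  \<open>W i s y\<close> being the component along the basis state \<open>s\<close> of the image of the basis vector \<open>y\<close>.\<close>

definition site_embedding ::
  "('v, 'e) network \<Rightarrow> nat \<Rightarrow> ('v \<Rightarrow> nat \<Rightarrow> ('e \<Rightarrow> nat) \<Rightarrow> complex) \<Rightarrow> bool" where
  "site_embedding N m W \<longleftrightarrow>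
     (\<forall>i\<in>verts N. \<forall>y\<in>(\<Pi>\<^sub>E e\<in>incident N i. {..<m}). \<forall>y'\<in>(\<Pi>\<^sub>E e\<in>incident N i. {..<m}).
        (\<Sum>s<sdim N i. cnj (W i s y) * W i s y') = of_bool (y = y'))"

definition embed_state ::
  "('v, 'e) network \<Rightarrow> nat \<Rightarrow> ('v \<Rightarrow> nat \<Rightarrow> ('e \<Rightarrow> nat) \<Rightarrow> complex) \<Rightarrow>
     ('v, 'e) virtual_state \<Rightarrow> 'v state" where
  "embed_state N m W \<phi> = (\<lambda>\<sigma>.
     if \<sigma> \<in> site_configs N
     then \<Sum>x\<in>virtual_configs N m.
            (\<Prod>i\<in>verts N. W i (\<sigma> i) (\<lambda>e\<in>incident N i. x (i, e))) * \<phi> x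
     else 0)"

definition normalized :: "('v, 'e) network \<Rightarrow> 'v state \<Rightarrow> 'v state" where
  "normalized N \<psi> = (\<lambda>\<sigma>. \<psi> \<sigma> / complex_of_real (state_norm N \<psi>))"

definition psi_T ::
  "('v, 'e) network \<Rightarrow> nat \<Rightarrow> ('v \<Rightarrow> nat \<Rightarrow> ('e \<Rightarrow> nat) \<Rightarrow> complex) \<Rightarrow>
     'v list \<Rightarrow> 'e list \<Rightarrow> real \<Rightarrow> 'v state" where
  "psi_T N m W vs es \<epsilon> = normalized N (embed_state N m W (loop_virtual_state N m vs es \<epsilon>))"


section \<open>Fine-graining\<close>

text \<open>A blocking scheme from a network \<open>N'\<close> onto a simple network \<open>N\<close> consists of the cluster
  assignment, for each site of \<open>N\<close> the identification of the product basis of its cluster with the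
  basis of the site, and for each edge of \<open>N\<close> the grouping of the bond indices of the
  corresponding edges of \<open>N'\<close> into one index.\<close>

record ('w, 'f, 'v, 'e) blocking =
  clus :: "'w \<Rightarrow> 'v"
  site_id :: "'v \<Rightarrow> ('w \<Rightarrow> nat) \<Rightarrow> nat"
  bond_id :: "'e \<Rightarrow> ('f \<Rightarrow> nat) \<Rightarrow> nat"

definition cluster ::
  "('w, 'f) network \<Rightarrow> ('w, 'f, 'v, 'e) blocking \<Rightarrow> 'v \<Rightarrow> 'w set" where
  "cluster N' b i = {j \<in> verts N'. clus b j = i}"

definition joining_edges ::
  "('w, 'f) network \<Rightarrow> ('v, 'e) network \<Rightarrow> ('w, 'f, 'v, 'e) blocking \<Rightarrow> 'e \<Rightarrow> 'f set" where
  "joining_edges N' N b e = {f \<in> edges N'. clus b ` ends N' f = ends N e}"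

definition inner_edges ::
  "('w, 'f) network \<Rightarrow> ('w, 'f, 'v, 'e) blocking \<Rightarrow> 'v \<Rightarrow> 'f set" where
  "inner_edges N' b i = {f \<in> edges N'. ends N' f \<subseteq> cluster N' b i}"

definition outer_edges ::
  "('w, 'f) network \<Rightarrow> ('w, 'f, 'v, 'e) blocking \<Rightarrow> 'v \<Rightarrow> 'f set" where
  "outer_edges N' b i =
     {f \<in> edges N'. ends N' f \<inter> cluster N' b i \<noteq> {}} - inner_edges N' b i"

definition cluster_configs ::
  "('w, 'f) network \<Rightarrow> ('w, 'f, 'v, 'e) blocking \<Rightarrow> 'v \<Rightarrow> ('w \<Rightarrow> nat) set" where
  "cluster_configs N' b i = (\<Pi>\<^sub>E j\<in>cluster N' b i. {..<sdim N' j})"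

definition blocking_scheme ::
  "('w, 'f) network \<Rightarrow> ('v, 'e) network \<Rightarrow> ('w, 'f, 'v, 'e) blocking \<Rightarrow> bool" where
  "blocking_scheme N' N b \<longleftrightarrow>
     clus b ` verts N' = verts N \<and>
     (\<forall>i\<in>verts N. sdim N i = (\<Prod>j\<in>cluster N' b i. sdim N' j)) \<and>
     (\<forall>f\<in>edges N'. (\<exists>i\<in>verts N. f \<in> inner_edges N' b i) \<or>
                    (\<exists>e\<in>edges N. f \<in> joining_edges N' N b e)) \<and>
     (\<forall>e\<in>edges N. bdim N e = (\<Prod>f\<in>joining_edges N' N b e. bdim N' f)) \<and>
     (\<forall>i\<in>verts N. bij_betw (site_id b i) (cluster_configs N' b i) {..<sdim N i}) \<and>
     (\<forall>e\<in>edges N. bij_betw (bond_id b e)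
                     (bond_configs N' (joining_edges N' N b e)) {..<bdim N e})"

text \<open>The tensors \<open>A\<close> arise from \<open>A'\<close> by contracting each cluster: \<open>\<sigma>\<close> are the site indices
  of the cluster, \<open>\<nu>\<close> the indices of the edges leaving it, and \<open>n\<close> the indices of the edges
  inside it, which are summed over.\<close>

definition blocked_tensors ::
  "('w, 'f) network \<Rightarrow> ('v, 'e) network \<Rightarrow> ('w, 'f, 'v, 'e) blocking \<Rightarrow>
     ('w, 'f) tensors \<Rightarrow> ('v, 'e) tensors \<Rightarrow> bool" where
  "blocked_tensors N' N b A' A \<longleftrightarrow>
     (\<forall>i\<in>verts N. \<forall>\<sigma>\<in>cluster_configs N' b i. \<forall>\<nu>\<in>bond_configs N' (outer_edges N' b i).
        A i (site_id b i \<sigma>)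
            (\<lambda>e\<in>incident N i. bond_id b e (restrict \<nu> (joining_edges N' N b e)))
        = (\<Sum>n\<in>bond_configs N' (inner_edges N' b i).
             \<Prod>j\<in>cluster N' b i.
               A' j (\<sigma> j) (restrict (override_on \<nu> n (inner_edges N' b i)) (incident N' j))))"

definition fine_grained_state ::
  "('w, 'f) network \<Rightarrow> ('v, 'e) network \<Rightarrow> ('w, 'f, 'v, 'e) blocking \<Rightarrow>
     'w state \<Rightarrow> 'v state \<Rightarrow> bool" where
  "fine_grained_state N' N b \<Psi>' \<Psi> \<longleftrightarrow>
     \<Psi>' \<in> PEPS N' \<and> \<Psi> \<in> PEPS N \<and> blocking_scheme N' N b \<and>
     (\<exists>A' A. \<Psi>' = contract N' A' \<and> \<Psi> = contract N A \<and> blocked_tensors N' N b A' A)"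

end

theory Submission
  imports Defs "Jordan_Normal_Form.Determinant"
begin

text \<open>As \<open>\<epsilon> \<rightarrow> 0\<close>, the states \<open>\<psi>\<^sub>T(\<epsilon>)\<close> converge to the normalized sum of all configurations of the
  edges in which the loop is constant, or has exactly one domain wall besides the one at its last
  vertex. This limit is not in \<open>PEPS(G)\<close>. Indeed, let \<open>p\<close> and \<open>q\<close> be the first two vertices of the
  loop, joined by \<open>e\<^sub>0\<close>, and suppose the limit has tensors \<open>B\<close>. Every local configuration at \<open>p\<close>
  or \<open>q\<close> extends to one that occurs in the limit, and the rest of the network determines it; since
  the bond dimensions are \<open>m\<close>, the square matrices \<open>B\<^sub>p\<close> and \<open>B\<^sub>q\<close> are invertible. Project all
  other sites onto the configuration \<open>0\<close>. Up to \<open>B\<^sub>p\<close> and \<open>B\<^sub>q\<close>, what remains on \<open>p\<close> and \<open>q\<close> is a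
  maximally entangled pair on \<open>e\<^sub>0\<close> times a vector on the other bonds, so its rank is a multiple of
  \<open>m\<close>; but the limit state gives a product vector, as a wall at \<open>p\<close> would need one at the last
  vertex. Blocking turns a PEPS of \<open>G'\<close> into one of \<open>G\<close> and is an isometry on states, so if
  \<open>PEPS(G')\<close> were closed, the limit would be in \<open>PEPS(G)\<close>.\<close>


section \<open>Blocking\<close>

lemma bij_betw_restrict_PiE_Union:
  assumes disj: "disjoint_family_on S I"
  shows "bij_betw (\<lambda>g. \<lambda>i\<in>I. restrict g (S i)) (PiE (\<Union>i\<in>I. S i) B) (PiE I (\<lambda>i. PiE (S i) B))"
  unfolding bij_betw_def
proof
  show "inj_on (\<lambda>g. \<lambda>i\<in>I. restrict g (S i)) (PiE (\<Union>i\<in>I. S i) B)"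
  proof (rule inj_onI)
    fix g h
    assume g: "g \<in> PiE (\<Union>i\<in>I. S i) B" and h: "h \<in> PiE (\<Union>i\<in>I. S i) B"
      and eq: "(\<lambda>i\<in>I. restrict g (S i)) = (\<lambda>i\<in>I. restrict h (S i))"
    show "g = h"
    proof (rule PiE_ext[OF g h])
      fix a assume "a \<in> (\<Union>i\<in>I. S i)"
      then obtain i where i: "i \<in> I" "a \<in> S i" by blast
      then show "g a = h a"
        using fun_cong[OF fun_cong[OF eq, of i], of a] by simp
    qed
  qed
  show "(\<lambda>g. \<lambda>i\<in>I. restrict g (S i)) ` PiE (\<Union>i\<in>I. S i) B = PiE I (\<lambda>i. PiE (S i) B)"
  proof (intro equalityI subsetI)
    fix h assume h: "h \<in> PiE I (\<lambda>i. PiE (S i) B)"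
    \<comment> \<open>The blocks are glued by looking up the block that contains \<open>a\<close>;
      disjointness makes the description by \<open>THE\<close> unique.\<close>
    define g where "g = (\<lambda>a\<in>(\<Union>i\<in>I. S i). h (THE i. i \<in> I \<and> a \<in> S i) a)"
    have the: "(THE i. i \<in> I \<and> a \<in> S i) = i" if "i \<in> I" "a \<in> S i" for i a
      using that disj by (intro the_equality) (auto simp: disjoint_family_on_def)
    have g_eq: "g a = h i a" if "i \<in> I" "a \<in> S i" for i a
      using that by (auto simp: g_def the)
    have "g \<in> PiE (\<Union>i\<in>I. S i) B"
    proof (rule PiE_I)
      fix a assume "a \<in> (\<Union>i\<in>I. S i)"
      then obtain i where i: "i \<in> I" "a \<in> S i" by blast
      then show "g a \<in> B a" using h by (auto simp: g_eq dest!: PiE_mem)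
    qed (simp add: g_def)
    moreover have "(\<lambda>i\<in>I. restrict g (S i)) = h"
    proof (rule PiE_ext[OF _ h])
      show "(\<lambda>i\<in>I. restrict g (S i)) \<in> PiE I (\<lambda>i. PiE (S i) B)"
        using \<open>g \<in> _\<close> by auto
      fix i assume i: "i \<in> I"
      have "h i \<in> extensional (S i)" using h i by (auto simp: PiE_def dest: PiE_mem)
      then show "(\<lambda>i\<in>I. restrict g (S i)) i = h i"
        using i g_eq by (auto simp: fun_eq_iff extensional_def)
    qed
    ultimately show "h \<in> (\<lambda>g. \<lambda>i\<in>I. restrict g (S i)) ` PiE (\<Union>i\<in>I. S i) B"
      by blast
  qed auto
qed

lemma bij_betw_PiE_map:
  assumes "\<And>i. i \<in> I \<Longrightarrow> bij_betw (f i) (A i) (B i)"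
  shows "bij_betw (\<lambda>g. \<lambda>i\<in>I. f i (g i)) (PiE I A) (PiE I B)"
proof (rule bij_betw_byWitness[where f' = "\<lambda>h. \<lambda>i\<in>I. inv_into (A i) (f i) (h i)"])
  note bij = assms[unfolded bij_betw_def]
  show "\<forall>g\<in>PiE I A. (\<lambda>i\<in>I. inv_into (A i) (f i) ((\<lambda>i\<in>I. f i (g i)) i)) = g"
    using bij by (auto simp: fun_eq_iff PiE_iff extensional_def)
  show "\<forall>h\<in>PiE I B. (\<lambda>i\<in>I. f i ((\<lambda>i\<in>I. inv_into (A i) (f i) (h i)) i)) = h"
    using bij by (auto simp: fun_eq_iff PiE_iff extensional_def f_inv_into_f)
  show "(\<lambda>g. \<lambda>i\<in>I. f i (g i)) ` PiE I A \<subseteq> PiE I B"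
    using bij by (auto simp: PiE_iff) blast
  show "(\<lambda>h. \<lambda>i\<in>I. inv_into (A i) (f i) (h i)) ` PiE I B \<subseteq> PiE I A"
    using bij by (auto simp: PiE_iff intro!: inv_into_into)
qed

text \<open>Common form of the two identifications in a blocking scheme: site indices grouped by
  clusters, and bond indices grouped by the joining edges of each edge.\<close>

lemma bij_betw_group_PiE:
  assumes "disjoint_family_on S I"
    and "\<And>i. i \<in> I \<Longrightarrow> bij_betw (f i) (PiE (S i) B) (C i)"
  shows "bij_betw (\<lambda>g. \<lambda>i\<in>I. f i (restrict g (S i))) (PiE (\<Union>i\<in>I. S i) B) (PiE I C)"
proof -
  have "bij_betw ((\<lambda>h. \<lambda>i\<in>I. f i (h i)) \<circ> (\<lambda>g. \<lambda>i\<in>I. restrict g (S i)))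
          (PiE (\<Union>i\<in>I. S i) B) (PiE I C)"
    by (rule bij_betw_trans[OF bij_betw_restrict_PiE_Union[OF assms(1)] bij_betw_PiE_map[OF assms(2)]])
  moreover have "(\<lambda>h. \<lambda>i\<in>I. f i (h i)) \<circ> (\<lambda>g. \<lambda>i\<in>I. restrict g (S i))
      = (\<lambda>g. \<lambda>i\<in>I. f i (restrict g (S i)))"
    by (auto simp: fun_eq_iff)
  ultimately show ?thesis by simp
qed

lemma sum_PiE_Un:
  assumes "S \<inter> T = {}"
  shows "(\<Sum>g\<in>PiE (S \<union> T) B. F g) = (\<Sum>\<nu>\<in>PiE S B. \<Sum>\<eta>\<in>PiE T B. F (override_on \<nu> \<eta> T))"
  unfolding sum.cartesian_product
  by (rule sum.reindex_bij_witness[where i = "\<lambda>(\<nu>, \<eta>). override_on \<nu> \<eta> T"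
        and j = "\<lambda>g. (restrict g S, restrict g T)"])
     (use assms in \<open>auto simp: override_on_def fun_eq_iff PiE_iff extensional_def
        intro!: arg_cong[of _ _ F]\<close>)

lemma sum_prod_PiE_Union:
  fixes g :: "'i \<Rightarrow> ('a \<Rightarrow> 'b) \<Rightarrow> 'c :: comm_semiring_1"
  assumes "disjoint_family_on S I" "finite I" "\<And>i. i \<in> I \<Longrightarrow> finite (PiE (S i) B)"
  shows "(\<Sum>\<eta>\<in>PiE (\<Union>i\<in>I. S i) B. \<Prod>i\<in>I. g i (restrict \<eta> (S i)))
       = (\<Prod>i\<in>I. \<Sum>\<eta>\<in>PiE (S i) B. g i \<eta>)"
proof -
  have "(\<Prod>i\<in>I. \<Sum>\<eta>\<in>PiE (S i) B. g i \<eta>) = (\<Sum>h\<in>PiE I (\<lambda>i. PiE (S i) B). \<Prod>i\<in>I. g i (h i))"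
    using assms by (intro prod_sum_PiE) auto
  also have "\<dots> = (\<Sum>\<eta>\<in>PiE (\<Union>i\<in>I. S i) B. \<Prod>i\<in>I. g i ((\<lambda>i\<in>I. restrict \<eta> (S i)) i))"
    by (rule sum.reindex_bij_betw[OF bij_betw_restrict_PiE_Union[OF assms(1)], symmetric])
  finally show ?thesis by simp
qed

section \<open>The combinatorics of a blocking scheme\<close>

lemma finite_bond_configs: "is_network N \<Longrightarrow> S \<subseteq> edges N \<Longrightarrow> finite (bond_configs N S)"
  unfolding bond_configs_def is_network_def by (auto intro!: finite_PiE intro: finite_subset)

definition block_config ::
  "('w, 'f) network \<Rightarrow> ('v, 'e) network \<Rightarrow> ('w, 'f, 'v, 'e) blocking \<Rightarrow> ('w \<Rightarrow> nat) \<Rightarrow> 'v \<Rightarrow> nat" where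
  "block_config N' N b \<sigma> = (\<lambda>i\<in>verts N. site_id b i (restrict \<sigma> (cluster N' b i)))"

locale blocked_network =
  fixes N' :: "('w, 'f) network" and N :: "('v, 'e) network" and b :: "('w, 'f, 'v, 'e) blocking"
  assumes simple: "simple_network N" and network': "is_network N'"
    and scheme: "blocking_scheme N' N b"
begin

lemma network: "is_network N"
  using simple by (simp add: simple_network_def)

lemma disjoint_clusters: "disjoint_family_on (cluster N' b) I"
  by (auto simp: disjoint_family_on_def cluster_def)

lemma Union_clusters: "(\<Union>i\<in>verts N. cluster N' b i) = verts N'"
  using scheme by (auto simp: blocking_scheme_def cluster_def)

lemma disjoint_inner: "disjoint_family_on (inner_edges N' b) I"
proof -
  have "ends N' f \<noteq> {}" if "f \<in> edges N'" for f
    using network' that by (force simp: is_network_def)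
  then show ?thesis
    by (fastforce simp: disjoint_family_on_def cluster_def inner_edges_def)
qed

text \<open>\<open>joining_edges\<close> depends on \<open>e\<close> only through its pair of ends,
  so this is where simplicity of \<open>N\<close> enters: distinct edges have distinct pairs of
  ends.\<close>

lemma disjoint_joining: "disjoint_family_on (joining_edges N' N b) (edges N)"
  using simple by (auto simp: disjoint_family_on_def joining_edges_def simple_network_def inj_on_def)

text \<open>A joining edge is mapped onto the two distinct ends of an edge of \<open>N\<close>, an
  inner edge into a single vertex.\<close>

lemma joining_inner_disjoint:
  assumes "e \<in> edges N" shows "joining_edges N' N b e \<inter> inner_edges N' b i = {}"
proof -
  have False if f: "clus b ` ends N' f = ends N e" "ends N' f \<subseteq> cluster N' b i" for f
  proof -
    have "ends N e \<subseteq> {i}" using f by (auto simp: cluster_def)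
    then have "card (ends N e) \<le> card {i}" by (rule card_mono[rotated]) simp
    then show False using network assms by (auto simp: is_network_def)
  qed
  then show ?thesis by (auto simp: joining_edges_def inner_edges_def)
qed

lemma edges_split:
  "edges N' = (\<Union>e\<in>edges N. joining_edges N' N b e) \<union> (\<Union>i\<in>verts N. inner_edges N' b i)"
  using scheme unfolding blocking_scheme_def
  by (auto simp: joining_edges_def inner_edges_def)

text \<open>An edge with one end in the cluster of \<open>i\<close> can be inner to no other
  cluster. If it is not inner to this one, the scheme makes it a joining edge of some
  \<open>e\<close>, and its end in the cluster forces \<open>i\<close> to be an end of
  \<open>e\<close>.\<close>

lemma outer_edges_eq:
  assumes "i \<in> verts N"
  shows "outer_edges N' b i = (\<Union>e\<in>incident N i. joining_edges N' N b e)"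
proof (intro equalityI subsetI)
  fix f assume f: "f \<in> outer_edges N' b i"
  then obtain w where w: "w \<in> ends N' f" "clus b w = i" and fe: "f \<in> edges N'"
    by (auto simp: outer_edges_def cluster_def)
  have "f \<notin> inner_edges N' b k" for k
  proof
    assume k: "f \<in> inner_edges N' b k"
    then have "k = i" using w by (auto simp: inner_edges_def cluster_def)
    with k f show False by (simp add: outer_edges_def)
  qed
  then obtain e where e: "e \<in> edges N" "f \<in> joining_edges N' N b e"
    using fe edges_split by blast
  moreover have "i \<in> ends N e" using e w by (auto simp: joining_edges_def)
  ultimately show "f \<in> (\<Union>e\<in>incident N i. joining_edges N' N b e)"
    by (auto simp: incident_def)
next
  fix f assume "f \<in> (\<Union>e\<in>incident N i. joining_edges N' N b e)"
  then obtain e where e: "e \<in> edges N" "i \<in> ends N e" "f \<in> joining_edges N' N b e"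
    by (auto simp: incident_def)
  then have f: "f \<in> edges N'" "clus b ` ends N' f = ends N e"
    by (auto simp: joining_edges_def)
  then obtain w where "w \<in> ends N' f" "clus b w = i" using e by force
  moreover have "w \<in> verts N'"
    using network' f \<open>w \<in> ends N' f\<close> by (auto simp: is_network_def)
  ultimately show "f \<in> outer_edges N' b i"
    using joining_inner_disjoint[OF e(1), of i] e f by (auto simp: outer_edges_def cluster_def)
qed

lemma bij_betw_bond_id:
  "e \<in> edges N \<Longrightarrow> bij_betw (bond_id b e)
     (PiE (joining_edges N' N b e) (\<lambda>f. {..<bdim N' f})) {..<bdim N e}"
  using scheme unfolding blocking_scheme_def bond_configs_def by blast

lemma bij_betw_block_bonds:
  assumes "S \<subseteq> edges N"
  shows "bij_betw (\<lambda>\<nu>. \<lambda>e\<in>S. bond_id b e (restrict \<nu> (joining_edges N' N b e)))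
    (bond_configs N' (\<Union>e\<in>S. joining_edges N' N b e)) (bond_configs N S)"
  unfolding bond_configs_def
proof (rule bij_betw_group_PiE)
  show "disjoint_family_on (joining_edges N' N b) S"
    using disjoint_joining assms by (rule disjoint_family_on_mono[rotated])
qed (use assms bij_betw_bond_id in auto)

lemma bij_betw_block_config:
  "bij_betw (block_config N' N b) (site_configs N') (site_configs N)"
proof -
  have "bij_betw (\<lambda>\<sigma>. \<lambda>i\<in>verts N. site_id b i (restrict \<sigma> (cluster N' b i)))
    (PiE (\<Union>i\<in>verts N. cluster N' b i) (\<lambda>j. {..<sdim N' j})) (PiE (verts N) (\<lambda>i. {..<sdim N i}))"
    by (rule bij_betw_group_PiE[OF disjoint_clusters])
      (use scheme in \<open>auto simp only: blocking_scheme_def cluster_configs_def\<close>)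
  then show ?thesis
    by (simp add: Union_clusters site_configs_def block_config_def[abs_def])
qed

lemma ex_blocked_tensors: "\<exists>A. blocked_tensors N' N b A' A"
proof -
  define g where "g i = (\<lambda>\<nu>. \<lambda>e\<in>incident N i. bond_id b e (restrict \<nu> (joining_edges N' N b e)))" for i
  \<comment> \<open>The original site and outgoing bond indices are recovered by
    \<open>inv_into\<close>. Both identifications are injective on the relevant configurations, so
    the equations required by \<open>blocked_tensors\<close> do not conflict.\<close>
  define A where "A i s t =
    (\<Sum>n\<in>bond_configs N' (inner_edges N' b i). \<Prod>j\<in>cluster N' b i.
       A' j (inv_into (cluster_configs N' b i) (site_id b i) s j)
         (restrict (override_on (inv_into (bond_configs N' (outer_edges N' b i)) (g i) t) n
            (inner_edges N' b i)) (incident N' j)))" for i s t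
  have "inj_on (site_id b i) (cluster_configs N' b i)"
    and "inj_on (g i) (bond_configs N' (outer_edges N' b i))" if "i \<in> verts N" for i
  proof -
    show "inj_on (site_id b i) (cluster_configs N' b i)"
      using scheme that by (auto simp: blocking_scheme_def dest: bij_betw_imp_inj_on)
    show "inj_on (g i) (bond_configs N' (outer_edges N' b i))"
      using bij_betw_block_bonds[of "incident N i"] outer_edges_eq[OF that]
      by (auto simp: g_def[abs_def] incident_def dest: bij_betw_imp_inj_on)
  qed
  moreover have "(\<lambda>e\<in>incident N i. bond_id b e (restrict \<nu> (joining_edges N' N b e))) = g i \<nu>" for i \<nu>
    by (simp add: g_def)
  ultimately have "blocked_tensors N' N b A' A"
    unfolding blocked_tensors_def by (simp add: A_def)
  then show ?thesis by blast
qed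

text \<open>The bond sum of \<open>N'\<close> splits into joining and inner edges. Inner edges of
  different clusters are summed independently, which turns each cluster into one blocked tensor, and
  the remaining sum over joining edges is a sum over the bonds of \<open>N\<close>.\<close>

lemma contract_blocked:
  assumes tens: "blocked_tensors N' N b A' A" and \<sigma>: "\<sigma> \<in> site_configs N'"
  shows "contract N' A' \<sigma> = contract N A (block_config N' N b \<sigma>)"
proof -
  define J where "J = joining_edges N' N b"
  define I where "I = inner_edges N' b"
  define JJ where "JJ = (\<Union>e\<in>edges N. J e)"
  define II where "II = (\<Union>i\<in>verts N. I i)"
  define B where "B = (\<lambda>f. {..<bdim N' f})"
  define cl where "cl = cluster N' b"
  define \<tau> where "\<tau> = block_config N' N b \<sigma>"
  define q where "q i \<nu> n = (\<Prod>j\<in>cl i. A' j (\<sigma> j) (restrict (override_on \<nu> n (I i)) (incident N' j)))"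
    for i \<nu> n
  have fin: "finite (verts N)" "finite (verts N')" "finite (edges N)" "finite (edges N')"
    using network network' by (auto simp: is_network_def)
  have JI: "JJ \<inter> II = {}"
    using joining_inner_disjoint by (auto simp: JJ_def II_def J_def I_def)
  have split: "edges N' = JJ \<union> II"
    by (simp add: JJ_def II_def J_def I_def edges_split)
  have outer: "outer_edges N' b i \<subseteq> JJ" if "i \<in> verts N" for i
    by (auto simp: outer_edges_eq[OF that] JJ_def J_def incident_def)
  have cases: "f \<in> outer_edges N' b i \<or> f \<in> I i" if "f \<in> incident N' j" "j \<in> cl i" for f j i
    using that by (auto simp: outer_edges_def I_def incident_def cl_def)
  have out_II: "outer_edges N' b i \<inter> II = {}" if "i \<in> verts N" for i
    using outer[OF that] JI by blast
  \<comment> \<open>A tensor in cluster \<open>i\<close> sees only inner and outer edges of that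
    cluster, so the global configuration may be cut down to these.\<close>
  have loc: "restrict (override_on \<nu> \<eta> II) (incident N' j) =
      restrict (override_on (restrict \<nu> (outer_edges N' b i)) (restrict \<eta> (I i)) (I i)) (incident N' j)"
    if "i \<in> verts N" "j \<in> cl i" for i j \<nu> \<eta>
  proof
    fix f
    show "restrict (override_on \<nu> \<eta> II) (incident N' j) f =
      restrict (override_on (restrict \<nu> (outer_edges N' b i)) (restrict \<eta> (I i)) (I i)) (incident N' j) f"
    proof (cases "f \<in> incident N' j")
      case True
      have "I i \<subseteq> II" using that by (auto simp: II_def)
      then show ?thesis using cases[OF True that(2)] out_II[OF that(1)] True
        by (auto simp: override_on_def)
    qed simp
  qed
  have \<tau>: "\<tau> \<in> site_configs N"
    using bij_betw_block_config \<sigma> by (auto simp: \<tau>_def bij_betw_def)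
  have \<sigma>_cl: "restrict \<sigma> (cl i) \<in> cluster_configs N' b i" for i
    using \<sigma> by (auto simp: cluster_configs_def site_configs_def cl_def cluster_def)
  have "contract N' A' \<sigma> = (\<Sum>n\<in>PiE (JJ \<union> II) B. \<Prod>j\<in>verts N'. A' j (\<sigma> j) (restrict n (incident N' j)))"
    using \<sigma> by (simp add: contract_def bond_configs_def split B_def)
  also have "\<dots> = (\<Sum>\<nu>\<in>PiE JJ B. \<Sum>\<eta>\<in>PiE II B.
      \<Prod>j\<in>verts N'. A' j (\<sigma> j) (restrict (override_on \<nu> \<eta> II) (incident N' j)))"
    by (rule sum_PiE_Un[OF JI])
  also have "\<dots> = (\<Sum>\<nu>\<in>PiE JJ B. \<Sum>\<eta>\<in>PiE II B.
      \<Prod>i\<in>verts N. q i (restrict \<nu> (outer_edges N' b i)) (restrict \<eta> (I i)))"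
  proof (intro sum.cong refl)
    fix \<nu> \<eta>
    have "(\<Prod>j\<in>verts N'. A' j (\<sigma> j) (restrict (override_on \<nu> \<eta> II) (incident N' j)))
      = (\<Prod>i\<in>verts N. \<Prod>j\<in>cl i. A' j (\<sigma> j) (restrict (override_on \<nu> \<eta> II) (incident N' j)))"
      unfolding Union_clusters[symmetric] cl_def
      by (rule prod.UNION_disjoint) (use fin disjoint_clusters in \<open>auto simp: cluster_def\<close>)
    also have "\<dots> = (\<Prod>i\<in>verts N. q i (restrict \<nu> (outer_edges N' b i)) (restrict \<eta> (I i)))"
      unfolding q_def by (intro prod.cong refl) (simp add: loc)
    finally show "(\<Prod>j\<in>verts N'. A' j (\<sigma> j) (restrict (override_on \<nu> \<eta> II) (incident N' j)))
      = (\<Prod>i\<in>verts N. q i (restrict \<nu> (outer_edges N' b i)) (restrict \<eta> (I i)))" .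
  qed
  also have "\<dots> = (\<Sum>\<nu>\<in>PiE JJ B. \<Prod>i\<in>verts N. \<Sum>n\<in>PiE (I i) B. q i (restrict \<nu> (outer_edges N' b i)) n)"
    unfolding II_def I_def
  proof (intro sum.cong refl sum_prod_PiE_Union disjoint_inner fin)
    fix i show "finite (PiE (inner_edges N' b i) B)"
      using finite_bond_configs[OF network', of "inner_edges N' b i"]
      by (simp add: bond_configs_def B_def inner_edges_def)
  qed
  also have "\<dots> = (\<Sum>\<nu>\<in>bond_configs N' JJ. \<Prod>i\<in>verts N. A i (\<tau> i)
      (restrict (\<lambda>e\<in>edges N. bond_id b e (restrict \<nu> (J e))) (incident N i)))"
  proof (unfold B_def bond_configs_def[symmetric], intro sum.cong prod.cong refl)
    fix \<nu> i assume \<nu>: "\<nu> \<in> bond_configs N' JJ" and i: "i \<in> verts N"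
    define \<nu>' where "\<nu>' = restrict \<nu> (outer_edges N' b i)"
    have \<nu>': "\<nu>' \<in> bond_configs N' (outer_edges N' b i)"
      using \<nu> outer[OF i] by (auto simp: \<nu>'_def bond_configs_def)
    have "A i (site_id b i (restrict \<sigma> (cl i))) (\<lambda>e\<in>incident N i. bond_id b e (restrict \<nu>' (J e)))
      = (\<Sum>n\<in>bond_configs N' (I i). \<Prod>j\<in>cl i. A' j (restrict \<sigma> (cl i) j)
          (restrict (override_on \<nu>' n (I i)) (incident N' j)))"
      using tens i \<sigma>_cl[of i] \<nu>' unfolding blocked_tensors_def J_def I_def cl_def by blast
    also have "\<dots> = (\<Sum>n\<in>bond_configs N' (I i). q i \<nu>' n)"
      by (simp add: q_def)
    also have "site_id b i (restrict \<sigma> (cl i)) = \<tau> i"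
      using i by (simp add: \<tau>_def block_config_def cl_def)
    also have "(\<lambda>e\<in>incident N i. bond_id b e (restrict \<nu>' (J e)))
      = restrict (\<lambda>e\<in>edges N. bond_id b e (restrict \<nu> (J e))) (incident N i)"
    proof (rule restrict_ext)
      fix e assume e: "e \<in> incident N i"
      then have "J e \<subseteq> outer_edges N' b i" by (auto simp: outer_edges_eq[OF i] J_def)
      then have "restrict \<nu>' (J e) = restrict \<nu> (J e)"
        by (auto simp: \<nu>'_def fun_eq_iff)
      then show "bond_id b e (restrict \<nu>' (J e)) = (\<lambda>e\<in>edges N. bond_id b e (restrict \<nu> (J e))) e"
        using e by (simp add: incident_def)
    qed
    finally show "(\<Sum>n\<in>bond_configs N' (I i). q i (restrict \<nu> (outer_edges N' b i)) n)
      = A i (\<tau> i) (restrict (\<lambda>e\<in>edges N. bond_id b e (restrict \<nu> (J e))) (incident N i))"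
      unfolding \<nu>'_def by (rule sym)
  qed
  also have "\<dots> = (\<Sum>n\<in>bond_configs N (edges N). \<Prod>i\<in>verts N. A i (\<tau> i) (restrict n (incident N i)))"
    unfolding JJ_def J_def by (rule sum.reindex_bij_betw[OF bij_betw_block_bonds[OF order_refl]])
  also have "\<dots> = contract N A \<tau>"
    using \<tau> by (simp add: contract_def)
  finally show ?thesis by (simp add: \<tau>_def)
qed

end

text \<open>A one-sided inverse of a square matrix is two-sided; an enumeration of \<open>Y\<close>
  moves this fact to matrices indexed by a finite set. It will be applied to site tensors, whose
  site and bond indices range over the same set of labels.\<close>

lemma left_inverse_imp_right_inverse_on:
  fixes f g :: "'a \<Rightarrow> 'a \<Rightarrow> 'c :: field"
  assumes fin: "finite Y"
    and inv: "\<And>y z. y \<in> Y \<Longrightarrow> z \<in> Y \<Longrightarrow> (\<Sum>t\<in>Y. f y t * g t z) = of_bool (y = z)"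
    and "y \<in> Y" "z \<in> Y"
  shows "(\<Sum>t\<in>Y. g y t * f t z) = of_bool (y = z)"
proof -
  define n where "n = card Y"
  obtain h where h: "bij_betw h {0..<n} Y"
    using fin ex_bij_betw_nat_finite n_def by blast
  have h_eq: "h i = h j \<longleftrightarrow> i = j" if "i < n" "j < n" for i j
    using h that by (auto simp: bij_betw_def inj_on_def)
  have h_in: "h i \<in> Y" if "i < n" for i
    using h that by (auto simp: bij_betw_def)
  define F where "F = Matrix.mat n n (\<lambda>(i, j). f (h i) (h j))"
  define G where "G = Matrix.mat n n (\<lambda>(i, j). g (h i) (h j))"
  have sum_h: "(\<Sum>k = 0..<n. p (h k) * q (h k)) = (\<Sum>t\<in>Y. p t * q t)" for p q :: "'a \<Rightarrow> 'c"
    by (rule sum.reindex_bij_betw[OF h])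
  have "F * G = 1\<^sub>m n"
  proof (rule eq_matI)
    fix i j assume "i < dim_row (1\<^sub>m n)" "j < dim_col (1\<^sub>m n)"
    then show "(F * G) $$ (i, j) = 1\<^sub>m n $$ (i, j)"
      using sum_h[of "f (h i)" "\<lambda>t. g t (h j)"]
      by (simp add: F_def G_def scalar_prod_def inv h_in h_eq)
  qed (simp_all add: F_def G_def)
  then have GF: "G * F = 1\<^sub>m n"
    by (rule mat_mult_left_right_inverse[rotated 2]) (auto simp: F_def G_def)
  obtain i j where ij: "i < n" "j < n" "y = h i" "z = h j"
    using h assms(3,4) by (auto simp: bij_betw_def)
  then have "(\<Sum>t\<in>Y. g y t * f t z) = (G * F) $$ (i, j)"
    using sum_h[of "g (h i)" "\<lambda>t. f t (h j)"] by (simp add: F_def G_def scalar_prod_def)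
  then show ?thesis
    using ij by (simp add: GF h_eq)
qed

section \<open>Weights of loop configurations\<close>

text \<open>The edge through which the loop enters its vertex \<open>k\<close>. Adding
  \<open>length es\<close> first keeps the subtraction from truncating at \<open>k = 0\<close>,
  where the last edge is meant.\<close>

definition loop_in :: "'e list \<Rightarrow> nat \<Rightarrow> 'e" where
  "loop_in es k = es ! ((k + length es - 1) mod length es)"

definition loop_walls :: "'v list \<Rightarrow> 'e list \<Rightarrow> ('v \<times> 'e \<Rightarrow> nat) \<Rightarrow> nat set" where
  "loop_walls vs es x = {k. k < length vs \<and> x (vs ! k, loop_in es k) \<noteq> x (vs ! k, es ! k)}"

text \<open>The exponent of \<open>\<epsilon>\<close>: every wall contributes a factor \<open>\<epsilon>\<close>, except that a wall at the last
  vertex contributes \<open>1/\<epsilon>\<close>. The subtraction is never truncated on configurations that occur in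
  \<open>mu_state\<close>, as a loop cannot have exactly one wall.\<close>

definition wall_excess :: "'v list \<Rightarrow> 'e list \<Rightarrow> ('v \<times> 'e \<Rightarrow> nat) \<Rightarrow> nat" where
  "wall_excess vs es x = card (loop_walls vs es x - {length vs - 1})
     - of_bool (length vs - 1 \<in> loop_walls vs es x)"

text \<open>A form of the loop state that is polynomial in \<epsilon>, so that the value \<epsilon>
  = 0 makes sense and gives the limit.\<close>

definition two_domain_state ::
  "('v, 'e) network \<Rightarrow> 'v list \<Rightarrow> 'e list \<Rightarrow> real \<Rightarrow> ('v, 'e) virtual_state" where
  "two_domain_state N vs es \<epsilon> x = complex_of_real \<epsilon> ^ wall_excess vs es x * mu_state N x"

definition half_config :: "('v, 'e) network \<Rightarrow> ('v \<Rightarrow> 'e \<Rightarrow> nat) \<Rightarrow> 'v \<times> 'e \<Rightarrow> nat" where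
  "half_config N y = (\<lambda>h\<in>half_edges N. y (fst h) (snd h))"

section \<open>The loop operators are diagonal\<close>

lemma P_diag_eq: "a < m \<Longrightarrow> P_diag m (a, b) (c, d) = of_bool (a = b \<and> c = a \<and> d = a)"
proof -
  assume "a < m"
  have "P_diag m (a, b) (c, d) = (\<Sum>n<m. if n = a then of_bool (a = b \<and> c = a \<and> d = a) else 0)"
    unfolding P_diag_def by (intro sum.cong refl) auto
  then show ?thesis using \<open>a < m\<close> by simp
qed

lemma op_A_eq:
  "a < m \<Longrightarrow> op_A m \<epsilon> (a, b) (c, d)
    = of_bool (a = c \<and> b = d) * (if a = b then 1 else complex_of_real \<epsilon>)"
  by (auto simp: op_A_def P_off_def P_diag_eq)

lemma op_B_eq:
  "a < m \<Longrightarrow> \<epsilon> \<noteq> 0 \<Longrightarrow> op_B m \<epsilon> (a, b) (c, d)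
    = of_bool (a = c \<and> b = d) * (if a = b then 1 else 1 / complex_of_real \<epsilon>)"
  by (auto simp: op_B_def P_off_def P_diag_eq)

text \<open>Only the term with \<open>a = x h\<close> and \<open>b = x h'\<close> survives in the
  double sum, and it leaves \<open>x\<close> unchanged; the bounds by \<open>m\<close> put this term
  in range.\<close>

lemma apply_op_diagonal:
  assumes X: "\<And>c d. X (x h, x h') (c, d) = of_bool (x h = c \<and> x h' = d) * D"
    and "x h < m" "x h' < m"
  shows "apply_op m X h h' \<phi> x = D * \<phi> x"
proof -
  have "apply_op m X h h' \<phi> x
    = (\<Sum>a<m. \<Sum>b<m. if x h' = b then if x h = a then D * \<phi> (x(h := a, h' := b)) else 0 else 0)"
    unfolding apply_op_def X by (intro sum.cong refl) auto
  also have "\<dots> = (\<Sum>a<m. if x h = a then D * \<phi> (x(h := a)) else 0)"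
    using assms by (intro sum.cong refl) (auto simp: fun_upd_idem)
  also have "\<dots> = D * \<phi> x"
    using assms by simp
  finally show ?thesis .
qed

lemma prod_of_bool:
  "finite A \<Longrightarrow> (\<Prod>a\<in>A. of_bool (P a)) = (of_bool (\<forall>a\<in>A. P a) :: 'b :: comm_semiring_1)"
  by (induction A rule: finite_induct) auto

locale loop_network =
  fixes N :: "('v, 'e) network" and vs :: "'v list" and es :: "'e list"
  assumes simple: "simple_network N" and loop: "is_loop N vs es"
begin

abbreviation L :: nat where "L \<equiv> length vs"

lemma network: "is_network N"
  using simple by (simp add: simple_network_def)

lemma finite_verts: "finite (verts N)" and finite_edges: "finite (edges N)"
  using network by (auto simp: is_network_def)

lemma length_loop: "3 \<le> L" "length es = L"
  using loop by (auto simp: is_loop_def)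

lemma vs_in_verts: "k < L \<Longrightarrow> vs ! k \<in> verts N"
  and es_in_edges: "k < L \<Longrightarrow> es ! k \<in> edges N"
  using loop by (auto simp: is_loop_def)

lemma vs_eq_iff: "k < L \<Longrightarrow> l < L \<Longrightarrow> vs ! k = vs ! l \<longleftrightarrow> k = l"
  and es_eq_iff: "k < L \<Longrightarrow> l < L \<Longrightarrow> es ! k = es ! l \<longleftrightarrow> k = l"
  using loop by (auto simp: is_loop_def nth_eq_iff_index_eq)

lemma ends_Suc: "Suc k < L \<Longrightarrow> ends N (es ! k) = {vs ! k, vs ! Suc k}"
  and ends_last: "ends N (es ! (L - 1)) = {vs ! (L - 1), vs ! 0}"
proof -
  have "k < L \<Longrightarrow> ends N (es ! k) = {vs ! k, vs ! (Suc k mod L)}" for k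
    using loop by (auto simp: is_loop_def)
  moreover have "Suc (L - 1) = L" using length_loop by simp
  ultimately show "Suc k < L \<Longrightarrow> ends N (es ! k) = {vs ! k, vs ! Suc k}"
    and "ends N (es ! (L - 1)) = {vs ! (L - 1), vs ! 0}"
    using length_loop by (metis Suc_lessD mod_less, metis lessI mod_self)
qed

lemma loop_in_0: "loop_in es 0 = es ! (L - 1)"
  using length_loop by (simp add: loop_in_def)

lemma loop_in_Suc: "Suc k < L \<Longrightarrow> loop_in es (Suc k) = es ! k"
  using length_loop by (simp add: loop_in_def)

lemma loop_half_edges:
  assumes "k < L"
  shows "(vs ! k, es ! k) \<in> half_edges N" "(vs ! k, loop_in es k) \<in> half_edges N"
proof -
  have "vs ! k \<in> ends N (es ! k)"
  proof (cases "Suc k < L")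
    case False
    then have "k = L - 1" using assms by simp
    then show ?thesis using ends_last by simp
  qed (simp add: ends_Suc)
  moreover have "vs ! k \<in> ends N (loop_in es k) \<and> loop_in es k \<in> edges N"
  proof (cases k)
    case 0
    then show ?thesis using ends_last es_in_edges[of "L - 1"] assms by (simp add: loop_in_0)
  next
    case (Suc l)
    then show ?thesis using ends_Suc[of l] es_in_edges[of l] assms by (simp add: loop_in_Suc)
  qed
  ultimately show "(vs ! k, es ! k) \<in> half_edges N" "(vs ! k, loop_in es k) \<in> half_edges N"
    using assms vs_in_verts es_in_edges by (auto simp: half_edges_def incident_def)
qed

lemma mu_state_eq:
  "mu_state N x = of_bool (\<forall>e\<in>edges N. \<forall>i\<in>ends N e. \<forall>j\<in>ends N e. x (i, e) = x (j, e))"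
  unfolding mu_state_def using finite_edges by (rule prod_of_bool)

text \<open>Labels agree at the two ends of an edge, so along the loop they change only at walls.
  After one full turn the label must return to its value, which a single change prevents.\<close>

lemma loop_walls_not_last:
  assumes mu: "mu_state N x \<noteq> 0" and walls: "loop_walls vs es x \<subseteq> {L - 1}"
  shows "loop_walls vs es x = {}"
proof -
  have agree: "x (i, e) = x (j, e)" if "e \<in> edges N" "i \<in> ends N e" "j \<in> ends N e" for i j e
    using mu that unfolding mu_state_eq of_bool_eq_0_iff not_not by blast
  have no_wall: "x (vs ! k, loop_in es k) = x (vs ! k, es ! k)" if "k < L - 1" for k
  proof -
    have "k \<noteq> L - 1" "k < L" using that by linarith+
    then have "k \<notin> loop_walls vs es x" using walls by blast
    then show ?thesis using \<open>k < L\<close> unfolding loop_walls_def by blast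
  qed
  have chain: "x (vs ! k, es ! k) = x (vs ! 0, es ! 0)" if "k < L - 1" for k
    using that
  proof (induction k)
    case (Suc k)
    have "x (vs ! Suc k, es ! Suc k) = x (vs ! Suc k, es ! k)"
      using no_wall[of "Suc k"] Suc.prems loop_in_Suc[of k] by simp
    also have "\<dots> = x (vs ! k, es ! k)"
      using Suc.prems ends_Suc[of k] by (intro agree es_in_edges) auto
    finally show ?case using Suc by simp
  qed simp
  \<comment> \<open>With \<open>L = Suc (Suc l)\<close> the last vertex has index
    \<open>Suc l\<close>. Its incoming label is followed back along the loop to vertex 0, whose
    incoming edge is the outgoing edge of the last vertex.\<close>
  define l where "l = L - 2"
  then have l: "L = Suc (Suc l)" using length_loop by simp
  have "x (vs ! Suc l, loop_in es (Suc l)) = x (vs ! Suc l, es ! l)"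
    using loop_in_Suc[of l] l by simp
  also have "\<dots> = x (vs ! l, es ! l)"
    using ends_Suc[of l] l by (intro agree es_in_edges) auto
  also have "\<dots> = x (vs ! 0, es ! Suc l)"
    using chain[of l] no_wall[of 0] l loop_in_0 by simp
  also have "\<dots> = x (vs ! Suc l, es ! Suc l)"
    using ends_last l by (intro agree es_in_edges) auto
  finally have "L - 1 \<notin> loop_walls vs es x" using l by (simp add: loop_walls_def)
  then show ?thesis using walls by blast
qed

lemma loop_op_eq:
  assumes "0 < \<epsilon>" and x: "x \<in> virtual_configs N m" and k: "k < L"
  shows "loop_op m \<epsilon> vs es k \<phi> x
    = (if k \<in> loop_walls vs es x then if k = L - 1 then 1 / complex_of_real \<epsilon> else complex_of_real \<epsilon>
       else 1) * \<phi> x"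
proof -
  have lt: "x h < m" if "h \<in> half_edges N" for h
    using x that by (auto simp: virtual_configs_def PiE_iff)
  show ?thesis
    unfolding loop_op_def Let_def length_loop(2)[symmetric] loop_in_def[symmetric]
    using k lt[OF loop_half_edges(1)[OF k]] lt[OF loop_half_edges(2)[OF k]] \<open>0 < \<epsilon>\<close>
    by (intro apply_op_diagonal) (auto simp: op_A_eq op_B_eq loop_walls_def length_loop)
qed

text \<open>Each loop operator multiplies the coefficient at \<open>x\<close> by a number, so the
  whole loop contributes the product of these numbers over the walls of \<open>x\<close>.\<close>

lemma loop_virtual_state_eq:
  assumes "0 < \<epsilon>" and x: "x \<in> virtual_configs N m"
  shows "loop_virtual_state N m vs es \<epsilon> x = two_domain_state N vs es \<epsilon> x"
proof -
  define d where "d k = (if k \<in> loop_walls vs es x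
      then if k = L - 1 then 1 / complex_of_real \<epsilon> else complex_of_real \<epsilon> else 1)" for k
  define W where "W = loop_walls vs es x"
  have fold: "fold (loop_op m \<epsilon> vs es) ks \<phi> x = (\<Prod>k\<leftarrow>ks. d k) * \<phi> x" if "set ks \<subseteq> {..<L}" for ks \<phi>
    using that
    by (induction ks arbitrary: \<phi>) (auto simp: loop_op_eq[OF assms] d_def)
  have W: "finite W" "W \<subseteq> {..<L}" by (auto simp: W_def loop_walls_def)
  have "loop_virtual_state N m vs es \<epsilon> x = (\<Prod>k<L. d k) * mu_state N x"
    unfolding loop_virtual_state_def
    by (subst fold) (auto simp: prod.distinct_set_conv_list[symmetric] lessThan_atLeast0)
  also have "(\<Prod>k<L. d k) = (\<Prod>k\<in>W. d k)"
    using W by (intro prod.mono_neutral_right) (auto simp: d_def W_def)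
  also have "\<dots> = (\<Prod>k\<in>W - {L - 1}. d k) * (if L - 1 \<in> W then 1 / complex_of_real \<epsilon> else 1)"
  proof (cases "L - 1 \<in> W")
    case True
    then have "d (L - 1) = 1 / complex_of_real \<epsilon>"
      by (simp only: d_def W_def if_True refl)
    then show ?thesis
      by (simp only: prod.remove[OF W(1) True] True if_True mult.commute)
  qed simp
  also have "(\<Prod>k\<in>W - {L - 1}. d k) = complex_of_real \<epsilon> ^ card (W - {L - 1})"
    by (subst prod.cong[OF refl, of _ _ "\<lambda>_. complex_of_real \<epsilon>"]) (auto simp: d_def W_def)
  also have "\<dots> * (if L - 1 \<in> W then 1 / complex_of_real \<epsilon> else 1) * mu_state N x
      = two_domain_state N vs es \<epsilon> x"
  proof (cases "mu_state N x = 0")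
    case False
    \<comment> \<open>A wall at the last vertex is accompanied by another one, so the factor
      \<open>1 / \<epsilon>\<close> cancels and the natural subtraction in
      \<open>wall_excess\<close> is exact.\<close>
    then have *: "\<not> (L - 1 \<in> W \<and> W - {L - 1} = {})"
      using loop_walls_not_last[of x] by (auto simp: W_def)
    show ?thesis
    proof (cases "L - 1 \<in> W")
      case True
      then obtain c where c: "card (W - {L - 1}) = Suc c"
        using * W(1) by (metis card_gt_0_iff finite_Diff gr0_conv_Suc)
      show ?thesis
        unfolding two_domain_state_def wall_excess_def W_def[symmetric] c using True assms(1) by simp
    next
      case False
      then show ?thesis
        unfolding two_domain_state_def wall_excess_def W_def[symmetric] by simp
    qed
  qed (simp add: two_domain_state_def)
  finally show ?thesis .
qed

end

section \<open>The limit state is not a contraction\<close>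

text \<open>A tensor network whose site index at \<open>i\<close> is itself a labelling of the edges
  at \<open>i\<close>. When all bond dimensions are \<open>m\<close>, each \<open>B i\<close> is
  thus a square matrix on the labellings below \<open>m\<close>.\<close>

definition virtual_contract :: "('v, 'e) network \<Rightarrow>
    ('v \<Rightarrow> ('e \<Rightarrow> nat) \<Rightarrow> ('e \<Rightarrow> nat) \<Rightarrow> complex) \<Rightarrow> ('v \<Rightarrow> 'e \<Rightarrow> nat) \<Rightarrow> complex" where
  "virtual_contract N B y =
     (\<Sum>n\<in>bond_configs N (edges N). \<Prod>i\<in>verts N. B i (y i) (restrict n (incident N i)))"

context loop_network
begin

lemma ends_in_verts: "e \<in> edges N \<Longrightarrow> i \<in> ends N e \<Longrightarrow> i \<in> verts N"
  using network by (auto simp: is_network_def)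

lemma other_end:
  assumes "e \<in> incident N i"
  obtains k where "k \<noteq> i" "ends N e = {i, k}" "k \<in> verts N" "e \<in> incident N k"
proof -
  have e: "e \<in> edges N" "i \<in> ends N e" using assms by (auto simp: incident_def)
  have "card (ends N e) = 2" using network e by (auto simp: is_network_def)
  then obtain a a' where a: "ends N e = {a, a'}" "a \<noteq> a'"
    unfolding card_2_iff by blast
  define k where "k = (if i = a then a' else a)"
  have k: "k \<noteq> i" "ends N e = {i, k}"
    using a e(2) by (auto simp: k_def)
  have "k \<in> verts N" using e k by (intro ends_in_verts[of e]) auto
  then show ?thesis using e k by (intro that[of k]) (auto simp: incident_def)
qed

lemma half_config_apply:
  "e \<in> edges N \<Longrightarrow> i \<in> ends N e \<Longrightarrow> half_config N y (i, e) = y i e"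
  using ends_in_verts by (simp add: half_config_def half_edges_def incident_def)

lemma mu_half_config:
  "mu_state N (half_config N y)
    = of_bool (\<forall>e\<in>edges N. \<forall>i\<in>ends N e. \<forall>j\<in>ends N e. y i e = y j e)"
  unfolding mu_state_eq by (intro arg_cong[of _ _ of_bool] ball_cong refl)
    (simp only: half_config_apply)

lemma loop_walls_half_config:
  "loop_walls vs es (half_config N y) = {k. k < L \<and> y (vs ! k) (loop_in es k) \<noteq> y (vs ! k) (es ! k)}"
  unfolding loop_walls_def half_config_def
  by (intro Collect_cong conj_cong refl) (simp add: loop_half_edges)

lemma two_domain_0:
  "two_domain_state N vs es 0 x = of_bool (wall_excess vs es x = 0) * mu_state N x"
  by (auto simp: two_domain_state_def power_0_left)

text \<open>The alternative \<open>k < q \<or> k = L - 1\<close> places the incoming edge of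
  \<open>vs ! q\<close> on the arc from the last vertex to \<open>vs ! q\<close>; the construction
  of extensions of local labels relies on this.\<close>

lemma incident_loop:
  assumes "k < L" "q < L - 1" "es ! k \<in> incident N (vs ! q)"
  shows "k = q \<or> es ! k = loop_in es q \<and> (k < q \<or> k = L - 1)"
proof (cases "k = L - 1")
  case True
  then have "vs ! q = vs ! (L - 1) \<or> vs ! q = vs ! 0"
    using assms(3) ends_last by (auto simp: incident_def)
  then have "q = L - 1 \<or> q = 0"
    using assms vs_eq_iff[of q "L - 1"] vs_eq_iff[of q 0] by fastforce
  then show ?thesis using True assms(2) by (auto simp: loop_in_0)
next
  case False
  then have "Suc k < L" using assms by simp
  then have "vs ! q = vs ! k \<or> vs ! q = vs ! Suc k"
    using assms(3) ends_Suc[of k] by (auto simp: incident_def)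
  then have "q = k \<or> q = Suc k"
    using assms(1,2) \<open>Suc k < L\<close> vs_eq_iff[of q k] vs_eq_iff[of q "Suc k"] by fastforce
  then show ?thesis using \<open>Suc k < L\<close> by (auto simp: loop_in_Suc)
qed

end

section \<open>Invertibility of the tensors at loop vertices\<close>

locale uniform_loop_network = loop_network N vs es for N :: "('v, 'e) network" and vs es +
  fixes m :: nat
  assumes m: "2 \<le> m" and bdim: "e \<in> edges N \<Longrightarrow> bdim N e = m"
begin

abbreviation local_configs :: "'v \<Rightarrow> ('e \<Rightarrow> nat) set" where
  "local_configs i \<equiv> PiE (incident N i) (\<lambda>_. {..<m})"

abbreviation bonds :: "('e \<Rightarrow> nat) set" where
  "bonds \<equiv> bond_configs N (edges N)"

abbreviation at_site :: "('e \<Rightarrow> nat) \<Rightarrow> 'v \<Rightarrow> 'e \<Rightarrow> nat" where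
  "at_site n i \<equiv> restrict n (incident N i)"

lemma bonds_eq: "bonds = PiE (edges N) (\<lambda>_. {..<m})"
  unfolding bond_configs_def by (intro PiE_cong) (simp add: bdim)

lemma finite_bonds: "finite bonds"
  by (rule finite_bond_configs[OF network order_refl])

lemma finite_incident: "finite (incident N i)"
  using finite_edges by (simp add: incident_def)

lemma finite_local_configs: "finite (local_configs i)"
  by (intro finite_PiE finite_incident) simp

lemma at_site_local: "n \<in> bonds \<Longrightarrow> at_site n i \<in> local_configs i"
  unfolding bonds_eq by (auto simp: incident_def)

lemma at_site_image: "S \<subseteq> bonds \<Longrightarrow> (\<lambda>n. at_site n i) ` S \<subseteq> local_configs i"
  using at_site_local by blast

lemma loop_in_incident:
  assumes "k < L"
  shows "es ! k \<in> incident N (vs ! k)" "loop_in es k \<in> incident N (vs ! k)"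
  using loop_half_edges[OF assms] by (auto simp: half_edges_def)

lemma at_site_loop: "at_site n (vs ! k) (loop_in es k) = n (loop_in es k)"
    "at_site n (vs ! k) (es ! k) = n (es ! k)" if "k < L"
  using loop_in_incident[OF that] by simp_all

text \<open>The arc of the loop from the last vertex to \<open>vs ! q\<close> takes the incoming
  label of \<open>y\<close>, the remaining arc its outgoing label. Walls can then occur only at
  \<open>vs ! q\<close> and at the last vertex, and there simultaneously, so the excess is
  zero.\<close>

lemma extend_local_config:
  assumes q: "q < L - 1" and y: "y \<in> local_configs (vs ! q)"
  obtains n where "n \<in> bonds" "at_site n (vs ! q) = y"
    "two_domain_state N vs es 0 (half_config N (at_site n)) = 1"
proof -
  define v where "v k = (if k < q \<or> k = L - 1 then y (loop_in es q) else y (es ! q))" for k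
  \<comment> \<open>Edges at \<open>vs ! q\<close> follow \<open>y\<close>. Edges away from the loop
    and from \<open>vs ! q\<close> can carry any label, as they affect no wall; they receive
    \<open>y (es ! q)\<close>.\<close>
  define n where "n = (\<lambda>e\<in>edges N. if e \<in> incident N (vs ! q) then y e
    else if e \<in> (!) es ` {k. k < L \<and> (k < q \<or> k = L - 1)} then y (loop_in es q) else y (es ! q))"
  have qL: "q < L" using q by simp
  have y_lt: "y e < m" if "e \<in> incident N (vs ! q)" for e
    using y that by (auto simp: PiE_iff)
  have n_bonds: "n \<in> bonds"
    unfolding bonds_eq using y_lt loop_in_incident[OF qL] by (auto simp: n_def)
  have n_y: "at_site n (vs ! q) = y"
  proof
    fix e
    show "at_site n (vs ! q) e = y e"
      using y by (cases "e \<in> incident N (vs ! q)") (auto simp: n_def incident_def PiE_iff extensional_def)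
  qed
  have n_es: "n (es ! k) = v k" if k: "k < L" for k
  proof (cases "es ! k \<in> incident N (vs ! q)")
    case True
    then have "n (es ! k) = y (es ! k)" using es_in_edges[OF k] by (simp add: n_def)
    then show ?thesis using incident_loop[OF k q True] q by (auto simp: v_def)
  next
    case False
    have "es ! k \<in> (!) es ` {k. k < L \<and> (k < q \<or> k = L - 1)} \<longleftrightarrow> k < q \<or> k = L - 1"
      using k es_eq_iff[OF k] by blast
    then show ?thesis using False es_in_edges[OF k] by (simp add: n_def v_def)
  qed
  define Z where "Z = loop_walls vs es (half_config N (at_site n))"
  have Z: "k \<in> Z \<longleftrightarrow> k < L \<and> n (loop_in es k) \<noteq> n (es ! k)" for k
    unfolding Z_def loop_walls_half_config using at_site_loop[of k n] by auto
  have Z_eq: "k \<in> Z \<longleftrightarrow> (k = q \<or> k = L - 1) \<and> y (loop_in es q) \<noteq> y (es ! q)" if k: "k < L" for k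
  proof (cases k)
    case 0
    then have "k \<in> Z \<longleftrightarrow> v (L - 1) \<noteq> v 0"
      using k n_es[of "L - 1"] n_es[of 0] by (simp add: Z loop_in_0)
    then show ?thesis using 0 q by (auto simp: v_def)
  next
    case (Suc l)
    then have "k \<in> Z \<longleftrightarrow> v l \<noteq> v k"
      using k n_es[of l] n_es[of k] by (simp add: Z loop_in_Suc)
    then show ?thesis using Suc k q by (auto simp: v_def)
  qed
  have "wall_excess vs es (half_config N (at_site n)) = 0"
  proof (cases "y (loop_in es q) = y (es ! q)")
    case True
    then have "Z = {}" using Z Z_eq by blast
    then show ?thesis unfolding wall_excess_def Z_def by simp
  next
    case False
    then have "Z = {q, L - 1}" using Z Z_eq q qL by fastforce
    then show ?thesis using q unfolding wall_excess_def Z_def by simp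
  qed
  moreover have "mu_state N (half_config N (at_site n)) = 1"
    unfolding mu_half_config by (simp add: incident_def)
  ultimately show ?thesis
    using n_bonds n_y by (intro that[of n]) (simp_all add: two_domain_0)
qed

text \<open>Separates the tensor at \<open>i\<close> from its environment, the contraction of all
  other tensors with the bonds at \<open>i\<close> held fixed.\<close>

lemma virtual_contract_split:
  assumes "i \<in> verts N"
  shows "virtual_contract N B y = (\<Sum>t\<in>local_configs i. B i (y i) t *
    (\<Sum>n | n \<in> bonds \<and> at_site n i = t. \<Prod>k\<in>verts N - {i}. B k (y k) (at_site n k)))"
proof -
  have "virtual_contract N B y = (\<Sum>n\<in>bonds. B i (y i) (at_site n i) *
      (\<Prod>k\<in>verts N - {i}. B k (y k) (at_site n k)))"
    unfolding virtual_contract_def by (intro sum.cong refl prod.remove finite_verts assms)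
  also have "\<dots> = (\<Sum>t\<in>local_configs i. \<Sum>n | n \<in> bonds \<and> at_site n i = t.
      B i (y i) (at_site n i) * (\<Prod>k\<in>verts N - {i}. B k (y k) (at_site n k)))"
    by (rule sum.group[OF finite_bonds finite_local_configs at_site_image, symmetric]) simp
  finally show ?thesis by (simp add: sum_distrib_left)
qed

lemma virtual_contract_split2:
  assumes "i \<in> verts N" "j \<in> verts N" "i \<noteq> j"
  shows "virtual_contract N B y = (\<Sum>t\<in>local_configs i. \<Sum>s\<in>local_configs j.
    B i (y i) t * B j (y j) s *
    (\<Sum>n | n \<in> bonds \<and> at_site n i = t \<and> at_site n j = s.
       \<Prod>k\<in>verts N - {i, j}. B k (y k) (at_site n k)))"
proof -
  have "(\<Sum>n | n \<in> bonds \<and> at_site n i = t. \<Prod>k\<in>verts N - {i}. B k (y k) (at_site n k))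
     = (\<Sum>s\<in>local_configs j. B j (y j) s * (\<Sum>n | n \<in> bonds \<and> at_site n i = t \<and> at_site n j = s.
       \<Prod>k\<in>verts N - {i, j}. B k (y k) (at_site n k)))" for t
  proof -
    have "(\<Sum>n | n \<in> bonds \<and> at_site n i = t. \<Prod>k\<in>verts N - {i}. B k (y k) (at_site n k))
      = (\<Sum>n | n \<in> bonds \<and> at_site n i = t. B j (y j) (at_site n j) *
          (\<Prod>k\<in>verts N - {i} - {j}. B k (y k) (at_site n k)))"
      by (intro sum.cong refl prod.remove) (use finite_verts assms in auto)
    also have "\<dots> = (\<Sum>s\<in>local_configs j. \<Sum>n | n \<in> {n \<in> bonds. at_site n i = t} \<and> at_site n j = s.
        B j (y j) (at_site n j) * (\<Prod>k\<in>verts N - {i} - {j}. B k (y k) (at_site n k)))"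
      by (rule sum.group[OF _ finite_local_configs at_site_image, symmetric])
        (use finite_bonds in auto)
    also have "\<dots> = (\<Sum>s\<in>local_configs j. \<Sum>n | n \<in> bonds \<and> at_site n i = t \<and> at_site n j = s.
        B j (y j) s * (\<Prod>k\<in>verts N - {i, j}. B k (y k) (at_site n k)))"
      by (intro sum.cong) (auto simp: Diff_insert[symmetric] insert_commute)
    finally show ?thesis by (simp add: sum_distrib_left)
  qed
  then show ?thesis
    unfolding virtual_contract_split[OF assms(1)] by (simp add: sum_distrib_left mult.assoc)
qed

text \<open>Inserting at the other sites the configuration of an extension of \<open>z\<close> produces a right inverse
  of the tensor at \<open>vs ! q\<close>, one column for each \<open>z\<close>.\<close>

lemma local_tensor_left_inverse:
  assumes q: "q < L - 1" and c: "c \<noteq> 0"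
    and eq: "\<And>y. (\<And>i. i \<in> verts N \<Longrightarrow> y i \<in> local_configs i)
      \<Longrightarrow> virtual_contract N B y = c * two_domain_state N vs es 0 (half_config N y)"
  shows "\<exists>G. \<forall>t\<in>local_configs (vs ! q). \<forall>t'\<in>local_configs (vs ! q).
    (\<Sum>y\<in>local_configs (vs ! q). G t y * B (vs ! q) y t') = of_bool (t = t')"
proof -
  define i where "i = vs ! q"
  have i: "i \<in> verts N" using q vs_in_verts[of q] by (simp add: i_def)
  have "\<forall>z\<in>local_configs i. \<exists>n. n \<in> bonds \<and> at_site n i = z \<and>
    two_domain_state N vs es 0 (half_config N (at_site n)) = 1"
    using extend_local_config[OF q] unfolding i_def by metis
  then obtain \<rho> where \<rho>: "\<And>z. z \<in> local_configs i \<Longrightarrow> \<rho> z \<in> bonds"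
    "\<And>z. z \<in> local_configs i \<Longrightarrow> at_site (\<rho> z) i = z"
    "\<And>z. z \<in> local_configs i \<Longrightarrow> two_domain_state N vs es 0 (half_config N (at_site (\<rho> z))) = 1"
    by metis
  define R where "R t z = (\<Sum>n | n \<in> bonds \<and> at_site n i = t.
      \<Prod>k\<in>verts N - {i}. B k (at_site (\<rho> z) k) (at_site n k))" for t z
  have "(\<Sum>t\<in>local_configs i. B i y t * (R t z / c)) = of_bool (y = z)"
    if y: "y \<in> local_configs i" and z: "z \<in> local_configs i" for y z
  proof -
    define w where "w = (at_site (\<rho> z))(i := y)"
    have w: "w k \<in> local_configs k" for k
      using y at_site_local[OF \<rho>(1)[OF z]] by (auto simp: w_def)
    have "(\<Sum>t\<in>local_configs i. B i y t * R t z) = virtual_contract N B w"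
      unfolding virtual_contract_split[OF i] R_def
      by (intro sum.cong arg_cong2[of _ _ _ _ "(*)"] prod.cong refl) (auto simp: w_def)
    also have "\<dots> = c * two_domain_state N vs es 0 (half_config N w)"
      by (rule eq) (rule w)
    \<comment> \<open>If \<open>y\<close> and \<open>z\<close> differ on an edge \<open>e\<close>,
      the other end of \<open>e\<close> still carries \<open>z e\<close>, so the labels disagree
      along \<open>e\<close> and \<open>mu_state\<close> vanishes.\<close>
    also have "two_domain_state N vs es 0 (half_config N w) = of_bool (y = z)"
    proof (cases "y = z")
      case True
      then have "w = at_site (\<rho> z)" using \<rho>(2)[OF z] by (auto simp: w_def)
      then show ?thesis using True \<rho>(3)[OF z] by simp
    next
      case False
      then obtain e where e: "e \<in> incident N i" "y e \<noteq> z e"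
        using PiE_ext[OF y z] by blast
      obtain k where k: "k \<noteq> i" "ends N e = {i, k}" "e \<in> incident N k"
        using other_end[OF e(1)] by blast
      have "w k e = z e"
        using k e(1) fun_cong[OF \<rho>(2)[OF z], of e] by (simp add: w_def)
      then have "w i e \<noteq> w k e" using e(2) by (simp add: w_def)
      moreover have "e \<in> edges N" "i \<in> ends N e" "k \<in> ends N e"
        using e(1) k by (auto simp: incident_def)
      ultimately have "mu_state N (half_config N w) = 0"
        unfolding mu_half_config of_bool_eq_0_iff by blast
      then show ?thesis using False by (simp add: two_domain_0)
    qed
    finally show ?thesis using c by (simp flip: sum_divide_distrib)
  qed
  \<comment> \<open>The matrix of \<open>B i\<close> is square, so its right inverse is also a left
    inverse.\<close>
  then have "(\<Sum>t\<in>local_configs i. R y t / c * B i t z) = of_bool (y = z)"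
    if "y \<in> local_configs i" "z \<in> local_configs i" for y z
    using that
    by (intro left_inverse_imp_right_inverse_on[where f = "B i" and g = "\<lambda>t z. R t z / c"]
        finite_local_configs) auto
  then show ?thesis unfolding i_def[symmetric] by (intro exI[of _ "\<lambda>t y. R t y / c"]) blast
qed

end

lemma sum_swap4:
  "(\<Sum>a\<in>A. \<Sum>d\<in>D. \<Sum>t\<in>T. \<Sum>s\<in>S. f a d t s) = (\<Sum>t\<in>T. \<Sum>s\<in>S. \<Sum>a\<in>A. \<Sum>d\<in>D. f a d t s)"
proof -
  have "(\<Sum>a\<in>A. \<Sum>d\<in>D. \<Sum>t\<in>T. \<Sum>s\<in>S. f a d t s) = (\<Sum>a\<in>A. \<Sum>t\<in>T. \<Sum>d\<in>D. \<Sum>s\<in>S. f a d t s)"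
    by (intro sum.cong refl sum.swap)
  also have "\<dots> = (\<Sum>t\<in>T. \<Sum>a\<in>A. \<Sum>d\<in>D. \<Sum>s\<in>S. f a d t s)"
    by (rule sum.swap)
  also have "\<dots> = (\<Sum>t\<in>T. \<Sum>a\<in>A. \<Sum>s\<in>S. \<Sum>d\<in>D. f a d t s)"
    by (intro sum.cong refl sum.swap)
  also have "\<dots> = (\<Sum>t\<in>T. \<Sum>s\<in>S. \<Sum>a\<in>A. \<Sum>d\<in>D. f a d t s)"
    by (intro sum.cong refl sum.swap)
  finally show ?thesis .
qed

section \<open>Contradiction on the first loop edge\<close>

context uniform_loop_network
begin

text \<open>The last vertex of the loop carries only zeros and hence no wall, so zero excess leaves
  no wall anywhere else. Then the first edge has the label of the last edge, which is 0. Every other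
  edge at the two vertices leads to a site carrying zeros.\<close>

lemma two_domain_0_concentrated:
  assumes zero: "\<And>k e. k \<in> verts N \<Longrightarrow> k \<noteq> vs ! 0 \<Longrightarrow> k \<noteq> vs ! 1 \<Longrightarrow> e \<in> incident N k \<Longrightarrow> y k e = 0"
    and nz: "two_domain_state N vs es 0 (half_config N y) \<noteq> 0"
    and e: "e \<in> incident N i" "i = vs ! 0 \<or> i = vs ! 1"
  shows "y i e = 0"
proof -
  have agree: "y i e = y j e" if "e \<in> edges N" "i \<in> ends N e" "j \<in> ends N e" for i j e
  proof -
    have "mu_state N (half_config N y) \<noteq> 0"
      using nz unfolding two_domain_0 by (rule contrapos_nn) simp
    then show ?thesis
      unfolding mu_half_config of_bool_eq_0_iff not_not using that by blast
  qed
  have excess: "wall_excess vs es (half_config N y) = 0"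
    using nz unfolding two_domain_0 by (rule contrapos_np) simp
  have idx: "0 < L" "1 < L" "L - 1 < L" "L - 2 < L" "Suc (L - 2) = L - 1"
    using length_loop by auto
  \<comment> \<open>A loop has at least three vertices, so its last vertex is among the sites
    required to carry zeros.\<close>
  have vs_distinct: "vs ! (L - 1) \<noteq> vs ! 0" "vs ! (L - 1) \<noteq> vs ! 1" "vs ! 0 \<noteq> vs ! 1"
    using vs_eq_iff[of "L - 1" 0] vs_eq_iff[of "L - 1" 1] vs_eq_iff[of 0 1] length_loop idx by auto
  have last_zero: "y (vs ! (L - 1)) e = 0" if "e \<in> incident N (vs ! (L - 1))" for e
    using zero[OF vs_in_verts[OF idx(3)]] vs_distinct that by blast
  have e_last: "es ! (L - 1) \<in> incident N (vs ! (L - 1))"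
    using ends_last es_in_edges[OF idx(3)] by (simp add: incident_def)
  have "loop_in es (L - 1) = es ! (L - 2)"
    using loop_in_Suc[of "L - 2"] idx by simp
  then have "L - 1 \<notin> loop_walls vs es (half_config N y)"
    unfolding loop_walls_half_config using last_zero loop_in_incident[OF idx(3)] by simp
  then have "card (loop_walls vs es (half_config N y) - {L - 1}) = 0"
    using excess unfolding wall_excess_def by simp
  moreover have "finite (loop_walls vs es (half_config N y))"
    by (simp add: loop_walls_def)
  ultimately have "loop_walls vs es (half_config N y) - {L - 1} = {}"
    by simp
  then have "0 \<notin> loop_walls vs es (half_config N y)"
    using length_loop by auto
  then have "y (vs ! 0) (es ! 0) = y (vs ! 0) (es ! (L - 1))"
    unfolding loop_walls_half_config using idx by (simp add: loop_in_0)
  also have "\<dots> = y (vs ! (L - 1)) (es ! (L - 1))"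
    using ends_last es_in_edges[OF idx(3)] by (intro agree) auto
  also have "\<dots> = 0" by (rule last_zero[OF e_last])
  finally have zero_0: "y (vs ! 0) (es ! 0) = 0" .
  have ends_0: "ends N (es ! 0) = {vs ! 0, vs ! 1}"
    using ends_Suc[of 0] idx by simp
  obtain k where k: "k \<noteq> i" "ends N e = {i, k}" "k \<in> verts N" "e \<in> incident N k"
    using other_end[OF e(1)] .
  have e_edge: "e \<in> edges N" using e(1) by (simp add: incident_def)
  show ?thesis
  proof (cases "k = vs ! 0 \<or> k = vs ! 1")
    case True
    then have "ends N e = ends N (es ! 0)" using e(2) k(1,2) ends_0 by auto
    \<comment> \<open>The graph is simple, so only one edge joins the first two loop
      vertices.\<close>
    then have "e = es ! 0"
      using simple e_edge es_in_edges[OF idx(1)] by (auto simp: simple_network_def inj_on_def)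
    moreover have "i \<in> ends N e" "vs ! 0 \<in> ends N e"
      using k(2) \<open>ends N e = ends N (es ! 0)\<close> ends_0 by auto
    ultimately have "y i e = y (vs ! 0) (es ! 0)"
      using agree[OF e_edge] by blast
    then show ?thesis using zero_0 by simp
  next
    case False
    then have "y k e = 0" using zero k by blast
    moreover have "y i e = y k e" using k(2) e_edge by (intro agree) auto
    ultimately show ?thesis by simp
  qed
qed

text \<open>The environment \<eta> of \<open>p\<close> and \<open>q\<close> has incompatible
  properties: it is a product of a function of \<open>t\<close> and one of \<open>s\<close>, yet it
  is nonzero only when \<open>t\<close> and \<open>s\<close> agree on \<open>e0\<close>, and it does
  not change with their common value there. As \<open>m\<close> is at least 2, this forces it to
  vanish.\<close>

lemma two_domain_0_not_virtual_contract:
  assumes c: "c \<noteq> 0"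
    and eq: "\<And>y. (\<And>i. i \<in> verts N \<Longrightarrow> y i \<in> local_configs i)
      \<Longrightarrow> virtual_contract N B y = c * two_domain_state N vs es 0 (half_config N y)"
  shows False
proof -
  define p where "p = vs ! 0"
  define q where "q = vs ! 1"
  define e0 where "e0 = es ! 0"
  define z where "z i = (\<lambda>e\<in>incident N i. 0 :: nat)" for i
  have idx: "0 < L - 1" "1 < L - 1" "0 < L" "1 < L"
    using length_loop by auto
  have pq: "p \<in> verts N" "q \<in> verts N" "p \<noteq> q"
    using vs_in_verts idx vs_eq_iff[of 0 1] by (auto simp: p_def q_def)
  have e0: "e0 \<in> edges N" "ends N e0 = {p, q}" "e0 \<in> incident N p" "e0 \<in> incident N q"
    using ends_Suc[of 0] idx es_in_edges[of 0] by (auto simp: p_def q_def e0_def incident_def)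
  have z: "z i \<in> local_configs i" for i
    using m by (auto simp: z_def)
  define \<eta> where "\<eta> t s = (\<Sum>n | n \<in> bonds \<and> at_site n p = t \<and> at_site n q = s.
       \<Prod>k\<in>verts N - {p, q}. B k (z k) (at_site n k))" for t s
  obtain Gp where Gp: "\<And>t t'. t \<in> local_configs p \<Longrightarrow> t' \<in> local_configs p
      \<Longrightarrow> (\<Sum>y\<in>local_configs p. Gp t y * B p y t') = of_bool (t = t')"
    using local_tensor_left_inverse[of "0" c B, OF idx(1) c eq] unfolding p_def by blast
  obtain Gq where Gq: "\<And>t t'. t \<in> local_configs q \<Longrightarrow> t' \<in> local_configs q
      \<Longrightarrow> (\<Sum>y\<in>local_configs q. Gq t y * B q y t') = of_bool (t = t')"
    using local_tensor_left_inverse[of "1" c B, OF idx(2) c eq] unfolding q_def by blast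
  \<comment> \<open>The part of the state on \<open>p\<close> and \<open>q\<close> that remains when
    all other sites are projected onto the zero labels.\<close>
  define F where "F a d = (\<Sum>t\<in>local_configs p. \<Sum>s\<in>local_configs q. B p a t * B q d s * \<eta> t s)" for a d
  have F_eq: "F a d = of_bool (a = z p \<and> d = z q) * c"
    if ad: "a \<in> local_configs p" "d \<in> local_configs q" for a d
  proof -
    define y where "y = z(p := a, q := d)"
    have "F a d = virtual_contract N B y"
      unfolding virtual_contract_split2[OF pq] F_def \<eta>_def
      by (intro sum.cong arg_cong2[of _ _ _ _ "(*)"] prod.cong refl) (auto simp: y_def pq)
    also have "\<dots> = c * two_domain_state N vs es 0 (half_config N y)"
      by (rule eq) (use ad z in \<open>auto simp: y_def\<close>)
    also have "two_domain_state N vs es 0 (half_config N y) = of_bool (a = z p \<and> d = z q)"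
    proof (cases "a = z p \<and> d = z q")
      case True
      then have "y = z" by (auto simp: y_def)
      have "z i e = 0" if "e \<in> incident N i" for i e using that by (simp add: z_def)
      then have "loop_walls vs es (half_config N z) = {}"
        unfolding loop_walls_half_config using loop_in_incident by auto
      moreover have "mu_state N (half_config N z) = 1"
        unfolding mu_half_config by (simp add: z_def incident_def)
      ultimately show ?thesis
        using True \<open>y = z\<close> by (simp add: two_domain_0 wall_excess_def)
    next
      case False
      have "two_domain_state N vs es 0 (half_config N y) = 0"
      proof (rule ccontr)
        assume nz: "two_domain_state N vs es 0 (half_config N y) \<noteq> 0"
        have zero: "y i e = 0" if "e \<in> incident N i" "i = p \<or> i = q" for i e
          by (rule two_domain_0_concentrated[OF _ nz]) (use that in \<open>auto simp: y_def z_def p_def q_def\<close>)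
        have "a = z p"
          using zero[of _ p] pq by (intro PiE_ext[OF ad(1) z]) (simp add: y_def z_def)
        moreover have "d = z q"
          using zero[of _ q] by (intro PiE_ext[OF ad(2) z]) (simp add: y_def z_def)
        ultimately show False using False by simp
      qed
      then show ?thesis using False by simp
    qed
    finally show ?thesis by simp
  qed
  \<comment> \<open>Applying the left inverses \<open>Gp\<close> and \<open>Gq\<close> to
    \<open>F\<close> removes \<open>B p\<close> and \<open>B q\<close>; since \<open>F\<close> is
    concentrated at the zero labels, a product remains.\<close>
  have \<eta>_eq: "\<eta> t s = c * Gp t (z p) * Gq s (z q)"
    if ts: "t \<in> local_configs p" "s \<in> local_configs q" for t s
  proof -
    have "(\<Sum>a\<in>local_configs p. \<Sum>d\<in>local_configs q. Gp t a * Gq s d * F a d)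
      = (\<Sum>a\<in>local_configs p. \<Sum>d\<in>local_configs q. \<Sum>t'\<in>local_configs p. \<Sum>s'\<in>local_configs q.
          (Gp t a * B p a t') * (Gq s d * B q d s') * \<eta> t' s')"
      by (simp add: F_def sum_distrib_left mult_ac)
    also have "\<dots> = (\<Sum>t'\<in>local_configs p. \<Sum>s'\<in>local_configs q. \<Sum>a\<in>local_configs p. \<Sum>d\<in>local_configs q.
          (Gp t a * B p a t') * (Gq s d * B q d s') * \<eta> t' s')"
      by (rule sum_swap4)
    also have "\<dots> = (\<Sum>t'\<in>local_configs p. \<Sum>s'\<in>local_configs q.
        (\<Sum>a\<in>local_configs p. Gp t a * B p a t') * (\<Sum>d\<in>local_configs q. Gq s d * B q d s') * \<eta> t' s')"
      unfolding sum_product unfolding sum_distrib_right by (rule refl)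
    also have "\<dots> = (\<Sum>t'\<in>local_configs p. \<Sum>s'\<in>local_configs q.
        if s' = s then if t' = t then \<eta> t s else 0 else 0)"
      by (intro sum.cong refl) (auto simp: Gp Gq ts)
    also have "\<dots> = \<eta> t s"
      using ts by (simp add: sum.delta[OF finite_local_configs])
    finally have "\<eta> t s = (\<Sum>a\<in>local_configs p. \<Sum>d\<in>local_configs q. Gp t a * Gq s d * F a d)"
      by simp
    also have "\<dots> = (\<Sum>a\<in>local_configs p. \<Sum>d\<in>local_configs q.
        if d = z q then if a = z p then c * Gp t (z p) * Gq s (z q) else 0 else 0)"
      by (intro sum.cong refl) (auto simp: F_eq)
    also have "\<dots> = c * Gp t (z p) * Gq s (z q)"
      using z by (simp add: sum.delta[OF finite_local_configs])
    finally show ?thesis .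
  qed
  have agree: "t e0 = s e0" if "\<eta> t s \<noteq> 0" for t s
  proof -
    have "{n. n \<in> bonds \<and> at_site n p = t \<and> at_site n q = s} \<noteq> {}"
      using that unfolding \<eta>_def by (rule contrapos_nn) (simp only: sum.empty)
    then obtain n where n: "at_site n p = t" "at_site n q = s"
      by blast
    show ?thesis
      using fun_cong[OF n(1), of e0] fun_cong[OF n(2), of e0] e0 by simp
  qed
  \<comment> \<open>The edge \<open>e0\<close> ends only at \<open>p\<close> and \<open>q\<close>,
    so relabelling it changes none of the tensors that make up \<eta>.\<close>
  have shift: "\<eta> (t(e0 := d)) (s(e0 := d)) = \<eta> t s"
    if d: "d < m" and a: "t e0 = s e0" "s e0 < m" for t s d
    unfolding \<eta>_def
  proof (rule sum.reindex_bij_witness[where i = "\<lambda>n. n(e0 := d)" and j = "\<lambda>n. n(e0 := s e0)"])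
    have upd: "n(e0 := b) \<in> bonds" if "n \<in> bonds" "b < m" for n b
      using that e0(1) unfolding bonds_eq by (auto simp: PiE_iff extensional_def)
    have at: "at_site (n(e0 := b)) i = (at_site n i)(e0 := b)" if "e0 \<in> incident N i" for n i b
      using that by (auto simp: fun_eq_iff)
    have val: "n e0 = at_site n p e0" "n e0 = at_site n q e0" for n
      using e0 by simp_all
    fix n
    assume n: "n \<in> {n. n \<in> bonds \<and> at_site n p = t(e0 := d) \<and> at_site n q = s(e0 := d)}"
    show "(n(e0 := s e0))(e0 := d) = n" using n val(1)[of n] by (auto simp: fun_eq_iff)
    show "n(e0 := s e0) \<in> {n. n \<in> bonds \<and> at_site n p = t \<and> at_site n q = s}"
      using n upd[of n "s e0"] a by (auto simp: at e0 fun_upd_idem)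
    show "(\<Prod>k\<in>verts N - {p, q}. B k (z k) (at_site (n(e0 := s e0)) k))
       = (\<Prod>k\<in>verts N - {p, q}. B k (z k) (at_site n k))"
    proof (intro prod.cong refl arg_cong[of _ _ "B _ _"])
      fix k assume "k \<in> verts N - {p, q}"
      then have "e0 \<notin> incident N k" using e0 by (simp add: incident_def)
      then show "at_site (n(e0 := s e0)) k = at_site n k"
        by (auto simp: fun_eq_iff)
    qed
  next
    have upd: "n(e0 := b) \<in> bonds" if "n \<in> bonds" "b < m" for n b
      using that e0(1) unfolding bonds_eq by (auto simp: PiE_iff extensional_def)
    have at: "at_site (n(e0 := b)) i = (at_site n i)(e0 := b)" if "e0 \<in> incident N i" for n i b
      using that by (auto simp: fun_eq_iff)
    fix n
    assume n: "n \<in> {n. n \<in> bonds \<and> at_site n p = t \<and> at_site n q = s}"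
    then have "s = at_site n q" by simp
    then have val: "n e0 = s e0" using e0(4) by simp
    show "(n(e0 := d))(e0 := s e0) = n" using val by (auto simp: fun_eq_iff)
    show "n(e0 := d) \<in> {n. n \<in> bonds \<and> at_site n p = t(e0 := d) \<and> at_site n q = s(e0 := d)}"
      using n upd[of n d] d by (auto simp: at e0)
  qed
  have "F (z p) (z q) \<noteq> 0"
    using F_eq[OF z z] c by simp
  then obtain t where t: "t \<in> local_configs p"
      "(\<Sum>s\<in>local_configs q. B p (z p) t * B q (z q) s * \<eta> t s) \<noteq> 0"
    unfolding F_def by (rule sum.not_neutral_contains_not_neutral)
  from t(2) obtain s where s: "s \<in> local_configs q" "B p (z p) t * B q (z q) s * \<eta> t s \<noteq> 0"
    by (rule sum.not_neutral_contains_not_neutral)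
  then have \<eta>: "\<eta> t s \<noteq> 0" by simp
  have s_lt: "s e0 < m" using s(1) e0 by (auto simp: PiE_iff)
  \<comment> \<open>A second label for \<open>e0\<close>, available because \<open>m\<close> is at
    least 2. Changing it in \<open>t\<close> alone keeps both factors of \<eta> nonzero but breaks
    the agreement.\<close>
  define d where "d = (if s e0 = 0 then 1 else 0 :: nat)"
  have d: "d < m" "d \<noteq> s e0" using m by (auto simp: d_def)
  have t': "t(e0 := d) \<in> local_configs p" and s': "s(e0 := d) \<in> local_configs q"
    using t(1) s(1) d(1) e0 by (auto simp: PiE_iff extensional_def)
  have "\<eta> (t(e0 := d)) (s(e0 := d)) \<noteq> 0"
    using shift[of d t s, OF d(1) agree[OF \<eta>] s_lt] \<eta> by simp
  then have "Gp (t(e0 := d)) (z p) \<noteq> 0"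
    using \<eta>_eq[OF t' s'] by auto
  moreover have "Gq s (z q) \<noteq> 0"
    using \<eta> \<eta>_eq[OF t(1) s(1)] by auto
  ultimately have "\<eta> (t(e0 := d)) s \<noteq> 0"
    using \<eta>_eq[OF t' s(1)] c by simp
  then show False
    using agree[of "t(e0 := d)" s] d(2) by simp
qed

end

section \<open>Projection onto the virtual spaces and the limit\<close>

text \<open>The adjoint of the product of the isometries \<open>W i\<close>, expressed in
  coefficients.\<close>

definition site_projection :: "('v, 'e) network \<Rightarrow>
    ('v \<Rightarrow> nat \<Rightarrow> ('e \<Rightarrow> nat) \<Rightarrow> complex) \<Rightarrow> 'v state \<Rightarrow> ('v \<Rightarrow> 'e \<Rightarrow> nat) \<Rightarrow> complex" where
  "site_projection N W \<Psi> y =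
     (\<Sum>\<sigma>\<in>site_configs N. (\<Prod>i\<in>verts N. cnj (W i (\<sigma> i) (y i))) * \<Psi> \<sigma>)"

lemma sum_site_configs_prod:
  fixes g :: "'v \<Rightarrow> nat \<Rightarrow> complex"
  assumes "is_network N"
  shows "(\<Sum>\<sigma>\<in>site_configs N. \<Prod>i\<in>verts N. g i (\<sigma> i)) = (\<Prod>i\<in>verts N. \<Sum>s<sdim N i. g i s)"
  unfolding site_configs_def using assms
  by (intro prod_sum_PiE[symmetric]) (auto simp: is_network_def)

text \<open>The adjoint acts on each site separately, so it can be absorbed into the site tensors;
  the new tensors have edge labellings as site indices.\<close>

lemma site_projection_contract:
  assumes "is_network N"
  shows "site_projection N W (contract N A) y
    = virtual_contract N (\<lambda>i x t. \<Sum>s<sdim N i. cnj (W i s x) * A i s t) y"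
proof -
  have "site_projection N W (contract N A) y = (\<Sum>\<sigma>\<in>site_configs N. \<Sum>n\<in>bond_configs N (edges N).
      \<Prod>i\<in>verts N. cnj (W i (\<sigma> i) (y i)) * A i (\<sigma> i) (restrict n (incident N i)))"
    unfolding site_projection_def
    by (intro sum.cong refl) (simp add: contract_def sum_distrib_left prod.distrib)
  also have "\<dots> = (\<Sum>n\<in>bond_configs N (edges N). \<Sum>\<sigma>\<in>site_configs N.
      \<Prod>i\<in>verts N. cnj (W i (\<sigma> i) (y i)) * A i (\<sigma> i) (restrict n (incident N i)))"
    by (rule sum.swap)
  also have "\<dots> = virtual_contract N (\<lambda>i x t. \<Sum>s<sdim N i. cnj (W i s x) * A i s t) y"
    unfolding virtual_contract_def
    by (intro sum.cong refl)
      (rule sum_site_configs_prod[OF assms,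
        of "\<lambda>i s. cnj (W i s (y i)) * A i s (restrict _ (incident N i))"])
  finally show ?thesis .
qed

text \<open>An isometry followed by its adjoint is the identity: orthonormality at each site selects
  the one half-edge labelling whose restrictions are the given \<open>y i\<close>.\<close>

lemma site_projection_embed:
  assumes net: "is_network N" and W: "site_embedding N m W"
    and y: "\<And>i. i \<in> verts N \<Longrightarrow> y i \<in> PiE (incident N i) (\<lambda>_. {..<m})"
  shows "site_projection N W (embed_state N m W \<phi>) y = \<phi> (half_config N y)"
proof -
  define c where "c x i = (\<lambda>e\<in>incident N i. x (i, e))" for x :: "'a \<times> 'b \<Rightarrow> nat" and i
  have fin: "finite (verts N)" "finite (edges N)" using net by (auto simp: is_network_def)
  have fin_V: "finite (virtual_configs N m)"
    unfolding virtual_configs_def half_edges_def incident_def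
    using fin by (intro finite_PiE finite_SigmaI) auto
  have "site_projection N W (embed_state N m W \<phi>) y = (\<Sum>\<sigma>\<in>site_configs N. \<Sum>x\<in>virtual_configs N m.
      (\<Prod>i\<in>verts N. cnj (W i (\<sigma> i) (y i)) * W i (\<sigma> i) (c x i)) * \<phi> x)"
    unfolding site_projection_def
    by (intro sum.cong refl) (simp add: embed_state_def c_def sum_distrib_left prod.distrib mult.assoc)
  also have "\<dots> = (\<Sum>x\<in>virtual_configs N m. \<Sum>\<sigma>\<in>site_configs N.
      (\<Prod>i\<in>verts N. cnj (W i (\<sigma> i) (y i)) * W i (\<sigma> i) (c x i)) * \<phi> x)"
    by (rule sum.swap)
  also have "\<dots> = (\<Sum>x\<in>virtual_configs N m. if x = half_config N y then \<phi> x else 0)"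
  proof (intro sum.cong refl)
    fix x assume x: "x \<in> virtual_configs N m"
    have c_in: "c x i \<in> PiE (incident N i) (\<lambda>_. {..<m})" if "i \<in> verts N" for i
      using x that by (auto simp: c_def virtual_configs_def half_edges_def PiE_iff)
    have "(\<Sum>\<sigma>\<in>site_configs N. (\<Prod>i\<in>verts N. cnj (W i (\<sigma> i) (y i)) * W i (\<sigma> i) (c x i)) * \<phi> x)
      = (\<Prod>i\<in>verts N. \<Sum>s<sdim N i. cnj (W i s (y i)) * W i s (c x i)) * \<phi> x"
      unfolding sum_distrib_right[symmetric]
      by (simp only: sum_site_configs_prod[OF net, of "\<lambda>i s. cnj (W i s (y i)) * W i s (c x i)"])
    also have "(\<Prod>i\<in>verts N. \<Sum>s<sdim N i. cnj (W i s (y i)) * W i s (c x i))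
      = (\<Prod>i\<in>verts N. of_bool (y i = c x i))"
      using W y c_in unfolding site_embedding_def by (intro prod.cong refl) blast
    also have "\<dots> = of_bool (\<forall>i\<in>verts N. y i = c x i)"
      by (rule prod_of_bool[OF fin(1)])
    also have "(\<forall>i\<in>verts N. y i = c x i) \<longleftrightarrow> x = half_config N y"
    proof
      assume eq: "\<forall>i\<in>verts N. y i = c x i"
      show "x = half_config N y"
      proof (rule extensionalityI)
        show "x \<in> extensional (half_edges N)" using x by (simp add: virtual_configs_def PiE_def)
        show "half_config N y \<in> extensional (half_edges N)" by (simp add: half_config_def)
        fix h assume "h \<in> half_edges N"
        then show "x h = half_config N y h"
          using eq by (auto simp: half_config_def half_edges_def c_def)
      qed
    next
      assume x_eq: "x = half_config N y"
      show "\<forall>i\<in>verts N. y i = c x i"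
      proof
        fix i assume i: "i \<in> verts N"
        show "y i = c x i"
          by (rule PiE_ext[OF y[OF i] c_in[OF i]])
            (use i in \<open>simp add: c_def x_eq half_config_def half_edges_def\<close>)
      qed
    qed
    finally show "(\<Sum>\<sigma>\<in>site_configs N. (\<Prod>i\<in>verts N. cnj (W i (\<sigma> i) (y i)) * W i (\<sigma> i) (c x i)) * \<phi> x)
      = (if x = half_config N y then \<phi> x else 0)" by simp
  qed
  also have "\<dots> = \<phi> (half_config N y)"
  proof -
    have "half_config N y \<in> virtual_configs N m"
      using y by (auto simp: half_config_def virtual_configs_def half_edges_def PiE_iff)
    then show ?thesis using fin_V by simp
  qed
  finally show ?thesis .
qed

section \<open>Convergence of the loop states\<close>

lemma tendsto_state_norm:
  assumes "\<And>\<sigma>. \<sigma> \<in> site_configs N \<Longrightarrow> (\<lambda>k. \<psi> k \<sigma>) \<longlonglongrightarrow> \<phi> \<sigma>"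
  shows "(\<lambda>k. state_norm N (\<psi> k)) \<longlonglongrightarrow> state_norm N \<phi>"
  unfolding state_norm_def L2_set_def
  by (intro tendsto_real_sqrt tendsto_sum tendsto_power tendsto_norm assms)

context uniform_loop_network
begin

lemma psi_T_eq:
  assumes "0 < \<epsilon>"
  shows "psi_T N m W vs es \<epsilon> = normalized N (embed_state N m W (two_domain_state N vs es \<epsilon>))"
proof -
  have "embed_state N m W (loop_virtual_state N m vs es \<epsilon>)
      = embed_state N m W (two_domain_state N vs es \<epsilon>)"
    unfolding embed_state_def
    by (intro ext if_cong refl sum.cong) (simp add: loop_virtual_state_eq[OF assms])
  then show ?thesis by (simp add: psi_T_def)
qed

text \<open>Projecting back onto the virtual spaces recovers all coefficients, and an extension of
  the zero labels at the first vertex has coefficient 1.\<close>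

lemma state_norm_limit:
  assumes W: "site_embedding N m W"
  shows "state_norm N (embed_state N m W (two_domain_state N vs es 0)) \<noteq> 0"
proof
  assume "state_norm N (embed_state N m W (two_domain_state N vs es 0)) = 0"
  then have "embed_state N m W (two_domain_state N vs es 0) \<sigma> = 0" if "\<sigma> \<in> site_configs N" for \<sigma>
    using that finite_site_configs[OF network] by (simp add: state_norm_def L2_set_eq_0_iff)
  then have zero: "site_projection N W (embed_state N m W (two_domain_state N vs es 0)) y = 0" for y
    by (simp add: site_projection_def)
  have "(\<lambda>e\<in>incident N (vs ! 0). 0) \<in> local_configs (vs ! 0)" "0 < L - 1"
    using m length_loop by auto
  then obtain n where n: "n \<in> bonds" "two_domain_state N vs es 0 (half_config N (at_site n)) = 1"
    using extend_local_config by metis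
  then show False
    using zero[of "at_site n"] site_projection_embed[OF network W at_site_local[OF n(1)]] by simp
qed

text \<open>Before normalization each coefficient is polynomial in \<epsilon>; dividing by the norm
  is harmless because the norm of the limit is nonzero.\<close>

lemma psi_T_tendsto:
  assumes W: "site_embedding N m W"
  shows "(\<lambda>k. psi_T N m W vs es (1 / real (Suc k)) \<sigma>)
    \<longlonglongrightarrow> normalized N (embed_state N m W (two_domain_state N vs es 0)) \<sigma>"
proof -
  define \<Phi> where "\<Phi> \<epsilon> = embed_state N m W (two_domain_state N vs es \<epsilon>)" for \<epsilon>
  have "(\<lambda>k. 1 / real (Suc k)) \<longlonglongrightarrow> 0"
    by (rule LIMSEQ_Suc[OF lim_1_over_n])
  then have "(\<lambda>k. two_domain_state N vs es (1 / real (Suc k)) x) \<longlonglongrightarrow> two_domain_state N vs es 0 x" for x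
    unfolding two_domain_state_def by (intro tendsto_mult tendsto_power tendsto_of_real tendsto_const)
  then have lim: "(\<lambda>k. \<Phi> (1 / real (Suc k)) \<sigma>) \<longlonglongrightarrow> \<Phi> 0 \<sigma>" for \<sigma>
    unfolding \<Phi>_def embed_state_def
    by (cases "\<sigma> \<in> site_configs N") (simp_all only: if_True if_False tendsto_const,
      intro tendsto_sum tendsto_mult tendsto_const)
  then have "(\<lambda>k. state_norm N (\<Phi> (1 / real (Suc k)))) \<longlonglongrightarrow> state_norm N (\<Phi> 0)"
    by (intro tendsto_state_norm)
  then have "(\<lambda>k. normalized N (\<Phi> (1 / real (Suc k))) \<sigma>) \<longlonglongrightarrow> normalized N (\<Phi> 0) \<sigma>"
    unfolding normalized_def using state_norm_limit[OF W]
    by (intro tendsto_divide lim tendsto_of_real) (simp_all add: \<Phi>_def)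
  moreover have "psi_T N m W vs es (1 / real (Suc k)) = normalized N (\<Phi> (1 / real (Suc k)))" for k
    unfolding \<Phi>_def by (rule psi_T_eq) simp
  ultimately show ?thesis by (simp only: \<Phi>_def)
qed

lemma limit_not_contract:
  assumes W: "site_embedding N m W"
  shows "normalized N (embed_state N m W (two_domain_state N vs es 0)) \<noteq> contract N A"
proof
  define \<Phi> where "\<Phi> = embed_state N m W (two_domain_state N vs es 0)"
  define c where "c = 1 / complex_of_real (state_norm N \<Phi>)"
  assume "normalized N (embed_state N m W (two_domain_state N vs es 0)) = contract N A"
  then have eq: "contract N A = (\<lambda>\<sigma>. c * \<Phi> \<sigma>)"
    by (simp add: normalized_def \<Phi>_def c_def fun_eq_iff)
  have "c \<noteq> 0" using state_norm_limit[OF W] by (simp add: c_def \<Phi>_def)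
  then show False
  proof (rule two_domain_0_not_virtual_contract)
    fix y assume y: "\<And>i. i \<in> verts N \<Longrightarrow> y i \<in> local_configs i"
    have "virtual_contract N (\<lambda>i x t. \<Sum>s<sdim N i. cnj (W i s x) * A i s t) y
      = site_projection N W (\<lambda>\<sigma>. c * \<Phi> \<sigma>) y"
      by (simp add: site_projection_contract[OF network, symmetric] eq)
    also have "\<dots> = c * site_projection N W \<Phi> y"
      by (simp add: site_projection_def sum_distrib_left mult_ac)
    also have "site_projection N W \<Phi> y = two_domain_state N vs es 0 (half_config N y)"
      unfolding \<Phi>_def by (rule site_projection_embed[OF network W y])
    finally show "virtual_contract N (\<lambda>i x t. \<Sum>s<sdim N i. cnj (W i s x) * A i s t) y
      = c * two_domain_state N vs es 0 (half_config N y)" .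
  qed
qed

end

section \<open>Transfer to the fine-grained network\<close>

context blocked_network
begin

lemma fine_grained_state_eq:
  assumes "fine_grained_state N' N b \<Psi>' \<Psi>" "\<sigma> \<in> site_configs N'"
  shows "\<Psi>' \<sigma> = \<Psi> (block_config N' N b \<sigma>)"
  using assms contract_blocked unfolding fine_grained_state_def by blast

text \<open>Inverts blocking on states. It only relabels basis vectors through a bijection, so it
  also makes sense for a limit that is not known to be a PEPS.\<close>

definition unblock :: "'v state \<Rightarrow> 'w state" where
  "unblock \<Psi> = (\<lambda>\<sigma>. if \<sigma> \<in> site_configs N' then \<Psi> (block_config N' N b \<sigma>) else 0)"

lemma unblock_contractE:
  assumes "unblock \<Psi> = contract N' A'" and "\<Psi> \<in> state_space N"
  obtains A where "\<Psi> = contract N A"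
proof -
  obtain A where A: "blocked_tensors N' N b A' A" using ex_blocked_tensors by blast
  have "\<Psi> \<sigma> = contract N A \<sigma>" for \<sigma>
  proof (cases "\<sigma> \<in> site_configs N")
    case True
    then obtain \<sigma>' where \<sigma>': "\<sigma>' \<in> site_configs N'" "\<sigma> = block_config N' N b \<sigma>'"
      using bij_betw_block_config by (auto simp: bij_betw_def)
    have "\<Psi> \<sigma> = unblock \<Psi> \<sigma>'" using \<sigma>' by (simp add: unblock_def)
    then show ?thesis using contract_blocked[OF A \<sigma>'(1)] \<sigma>'(2) assms(1) by simp
  next
    case False
    then show ?thesis using assms(2) by (simp add: state_space_def contract_def)
  qed
  then show ?thesis by (intro that[of A] ext)
qed

end

theorem proposition9:
  fixes G :: "('v, 'e) network" and G' :: "('w, 'f) network"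
    and b :: "('w, 'f, 'v, 'e) blocking"
    and m :: nat and W :: "'v \<Rightarrow> nat \<Rightarrow> ('e \<Rightarrow> nat) \<Rightarrow> complex"
    and vs :: "'v list" and es :: "'e list"
  assumes "2 \<le> m"
    and "simple_network G"
    and "\<forall>e\<in>edges G. bdim G e = m"
    and "\<forall>i\<in>verts G. m ^ vdegree G i \<le> sdim G i"
    and "is_loop G vs es"
    and "site_embedding G m W"
    and "is_network G'"
    and "blocking_scheme G' G b"
    and "\<forall>\<epsilon>>0. \<exists>\<Psi>'. fine_grained_state G' G b \<Psi>' (psi_T G m W vs es \<epsilon>)"
  shows "\<not> closedin (norm_topology G') (PEPS G')"
proof
  assume closed: "closedin (norm_topology G') (PEPS G')"
  interpret blocked_network G' G b
    using assms by unfold_locales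
  interpret uniform_loop_network G vs es m
    using assms by unfold_locales auto
  interpret M: Metric_space "state_space G'" "state_dist G'"
    using assms(7) by (rule Metric_space_state)
  define \<Psi> where "\<Psi> k = psi_T G m W vs es (1 / real (Suc k))" for k
  define \<Psi>\<^sub>0 where "\<Psi>\<^sub>0 = normalized G (embed_state G m W (two_domain_state G vs es 0))"
  have "\<forall>k. \<exists>\<Psi>'. fine_grained_state G' G b \<Psi>' (\<Psi> k)"
    using assms(9) by (simp add: \<Psi>_def)
  then obtain \<Psi>' where \<Psi>': "fine_grained_state G' G b (\<Psi>' k) (\<Psi> k)" for k
    by metis
  have PEPS: "\<Psi>' k \<in> PEPS G'" for k
    using \<Psi>'[of k] by (simp add: fine_grained_state_def)
  \<comment> \<open>One blocking scheme serves all \<epsilon>, so every coefficient of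
    \<open>\<Psi>' k\<close> is the coefficient of \<open>\<Psi> k\<close> at the same blocked
    configuration, and convergence carries over coefficientwise.\<close>
  have "limitin M.mtopology \<Psi>' (unblock \<Psi>\<^sub>0) sequentially"
    unfolding M.limitin_metric_dist_null
  proof (intro conjI)
    show "unblock \<Psi>\<^sub>0 \<in> state_space G'"
      by (simp add: unblock_def state_space_def)
    show "\<forall>\<^sub>F k in sequentially. \<Psi>' k \<in> state_space G'"
      using PEPS PEPS_subset_state_space by (intro always_eventually) blast
    have "(\<lambda>k. state_norm G' (\<lambda>\<sigma>. \<Psi>' k \<sigma> - unblock \<Psi>\<^sub>0 \<sigma>)) \<longlonglongrightarrow> state_norm G' (\<lambda>\<sigma>. 0)"
    proof (rule tendsto_state_norm)
      fix \<sigma> assume \<sigma>: "\<sigma> \<in> site_configs G'"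
      have "(\<lambda>k. \<Psi> k (block_config G' G b \<sigma>) - \<Psi>\<^sub>0 (block_config G' G b \<sigma>)) \<longlonglongrightarrow> 0"
        using psi_T_tendsto[OF assms(6)] unfolding \<Psi>_def \<Psi>\<^sub>0_def by (rule LIM_zero)
      then show "(\<lambda>k. \<Psi>' k \<sigma> - unblock \<Psi>\<^sub>0 \<sigma>) \<longlonglongrightarrow> 0"
        using \<sigma> fine_grained_state_eq[OF \<Psi>' \<sigma>] by (simp add: unblock_def)
    qed
    then show "(\<lambda>k. state_dist G' (\<Psi>' k) (unblock \<Psi>\<^sub>0)) \<longlonglongrightarrow> 0"
      by (simp add: state_dist_def state_norm_def L2_set_def)
  qed
  \<comment> \<open>The limit of a convergent sequence from a closed set lies in that set; blocking
    its tensors then writes \<open>\<Psi>\<^sub>0\<close> as a contraction over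
    \<open>G\<close>.\<close>
  then have "unblock \<Psi>\<^sub>0 \<in> PEPS G'"
    using closed PEPS unfolding norm_topology_def M.metric_closedin_iff_sequentially_closed by blast
  then obtain A' where "unblock \<Psi>\<^sub>0 = contract G' A'"
    by (auto simp: PEPS_def)
  moreover have "\<Psi>\<^sub>0 \<in> state_space G"
    by (simp add: \<Psi>\<^sub>0_def state_space_def normalized_def embed_state_def)
  ultimately obtain A where "\<Psi>\<^sub>0 = contract G A"
    by (rule unblock_contractE)
  then show False
    using limit_not_contract[OF assms(6)] by (simp add: \<Psi>\<^sub>0_def)
qed

end
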